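(* Let $G$ be a finite group with non-isomorphic irreducible complex representations $\sigma_1,\ldots,\sigma_r$ and corresponding characters $\chi_1,\ldots,\chi_r$. Let $\rho:G\to\mathrm{GL}(V)$ be a finite-dimensional complex representation, let $N=\ker\rho$, and let $\Gamma_\rho(G)$ be the McKay quiver, with vertices $v_1,\ldots,v_r$. For any $i,j\in\{1,\ldots,r\}$, the following are equivalent: 1. $v_i$ and $v_j$ lie in the same strongly connected component of $\Gamma_\rho(G)$. 2. $v_i$ and $v_j$ lie in the same weakly connected component of $\Gamma_\rho(G)$. 3. The restricted characters $\chi_i\downarrow_N$ and $\chi_j\downarrow_N$ are (scalar) multiples of each other.
   Context: Let $\sigma_1,\dots,\sigma_r$ be a complete list of the irreducible complex representations of $G$ up to isomorphism, with $\sigma_1$ trivial. The McKay matrix $A_\rho(G)=(a_{ij})_{i,j=1}^r$ has as entries the non-negative integers determined by $\rho\otimes\sigma_i\cong\bigoplus_{j=1}^r\sigma_j^{\oplus a_{ij}}$. The McKay quiver $\Gamma_\rho(G)$ is the quiver with vertices $v_1,\dots,v_r$ and $a_{ij}$ directed edges from $v_i$ to $v_j$. A quiver is strongly connected if there is a directed path (possibly of length $0$) from any vertex to any other; it is weakly connected if the undirected graph obtained by forgetting edge directions is connected. Strongly (resp. weakly) connected components are the maximal strongly (resp. weakly) connected subquivers. $\downarrow_N$ denotes restriction to $N$. *)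

theory Defs
  imports
    Complex_Main
    "HOL-Algebra.Coset"
    "Jordan_Normal_Form.VS_Connect"
    "Graph_Theory.Digraph_Component"
begin

text \<open>A complex representation of degree \<open>n\<close> is given in coordinates, i.e. with \<open>V = \<complex>\<^sup>n\<close>;
  \<open>n = 0\<close> is allowed.\<close>

definition GL :: "nat \<Rightarrow> complex mat monoid" where
  "GL n = units_of (ring_mat TYPE(complex) n ())"

definition representation :: "('g, 'b) monoid_scheme \<Rightarrow> nat \<Rightarrow> ('g \<Rightarrow> complex mat) \<Rightarrow> bool" where
  "representation G n \<rho> \<longleftrightarrow> \<rho> \<in> hom G (GL n)"

definition irreducible_rep :: "('g, 'b) monoid_scheme \<Rightarrow> nat \<Rightarrow> ('g \<Rightarrow> complex mat) \<Rightarrow> bool" where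
  "irreducible_rep G n \<rho> \<longleftrightarrow>
     representation G n \<rho> \<and> 0 < n \<and>
     (\<forall>W. VectorSpace.subspace class_ring W (module_vec TYPE(complex) n) \<and>
          (\<forall>g\<in>carrier G. \<forall>w\<in>W. \<rho> g *\<^sub>v w \<in> W) \<longrightarrow>
          W = {0\<^sub>v n} \<or> W = carrier_vec n)"

text \<open>The same change of basis \<open>P\<close>, with inverse \<open>Q\<close>, has to work for all group elements.\<close>

definition rep_iso ::
    "('g, 'b) monoid_scheme \<Rightarrow> ('g \<Rightarrow> complex mat) \<Rightarrow> ('g \<Rightarrow> complex mat) \<Rightarrow> bool" where
  "rep_iso G \<rho> \<tau> \<longleftrightarrow> (\<exists>P Q. \<forall>g\<in>carrier G. similar_mat_wit (\<rho> g) (\<tau> g) P Q)"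

text \<open>Kronecker product: the basis vector \<open>e\<^sub>a \<otimes> e\<^sub>b\<close> has index \<open>a * dim + b\<close>, where
  \<open>dim\<close> is the dimension of the second factor.\<close>

definition kronecker :: "complex mat \<Rightarrow> complex mat \<Rightarrow> complex mat" where
  "kronecker A B = mat (dim_row A * dim_row B) (dim_col A * dim_col B)
     (\<lambda>(i, j). A $$ (i div dim_row B, j div dim_col B) * B $$ (i mod dim_row B, j mod dim_col B))"

definition tensor_rep :: "('g \<Rightarrow> complex mat) \<Rightarrow> ('g \<Rightarrow> complex mat) \<Rightarrow> 'g \<Rightarrow> complex mat" where
  "tensor_rep \<rho> \<tau> g = kronecker (\<rho> g) (\<tau> g)"

text \<open>\<open>multiplicity_sum r \<sigma> m\<close> is the direct sum of \<open>m j\<close> copies of \<open>\<sigma> j\<close> over all \<open>j < r\<close>.\<close>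

definition multiplicity_sum ::
    "nat \<Rightarrow> (nat \<Rightarrow> 'g \<Rightarrow> complex mat) \<Rightarrow> (nat \<Rightarrow> nat) \<Rightarrow> 'g \<Rightarrow> complex mat" where
  "multiplicity_sum r \<sigma> m g = diag_block_mat (concat (map (\<lambda>j. replicate (m j) (\<sigma> j g)) [0..<r]))"

definition character :: "('g \<Rightarrow> complex mat) \<Rightarrow> 'g \<Rightarrow> complex" where
  "character \<rho> g = (\<Sum>k<dim_row (\<rho> g). \<rho> g $$ (k, k))"

text \<open>The representations \<open>\<sigma>\<^sub>1, \<dots>, \<sigma>\<^sub>r\<close> are indexed from \<open>0\<close> here; \<open>d i\<close> is the degree of
  \<open>\<sigma> i\<close>.\<close>

definition complete_irreps ::
    "('g, 'b) monoid_scheme \<Rightarrow> nat \<Rightarrow> (nat \<Rightarrow> nat) \<Rightarrow> (nat \<Rightarrow> 'g \<Rightarrow> complex mat) \<Rightarrow> bool" where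
  "complete_irreps G r d \<sigma> \<longleftrightarrow>
     (\<forall>i<r. irreducible_rep G (d i) (\<sigma> i)) \<and>
     (\<forall>i<r. \<forall>j<r. i \<noteq> j \<longrightarrow> \<not> rep_iso G (\<sigma> i) (\<sigma> j)) \<and>
     (\<forall>n \<tau>. irreducible_rep G n \<tau> \<longrightarrow> (\<exists>i<r. rep_iso G \<tau> (\<sigma> i)))"

definition mckay_matrix ::
    "('g, 'b) monoid_scheme \<Rightarrow> nat \<Rightarrow> (nat \<Rightarrow> 'g \<Rightarrow> complex mat) \<Rightarrow> ('g \<Rightarrow> complex mat) \<Rightarrow> nat mat" where
  "mckay_matrix G r \<sigma> \<rho> =
     (THE A. A \<in> carrier_mat r r \<and>
        (\<forall>i<r. rep_iso G (tensor_rep \<rho> (\<sigma> i)) (multiplicity_sum r \<sigma> (\<lambda>j. A $$ (i, j)))))"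

text \<open>The vertex \<open>v\<^sub>i\<close> is \<open>i\<close>, and the arcs from \<open>i\<close> to \<open>j\<close> are the \<open>a\<^sub>i\<^sub>j\<close> many triples
  \<open>(i, j, k)\<close> with \<open>k < a\<^sub>i\<^sub>j\<close>.\<close>

definition mckay_quiver ::
    "('g, 'b) monoid_scheme \<Rightarrow> nat \<Rightarrow> (nat \<Rightarrow> 'g \<Rightarrow> complex mat) \<Rightarrow> ('g \<Rightarrow> complex mat) \<Rightarrow>
     (nat, nat \<times> nat \<times> nat) pre_digraph" where
  "mckay_quiver G r \<sigma> \<rho> =
     \<lparr> verts = {..<r},
       arcs = {(i, j, k). i < r \<and> j < r \<and> k < mckay_matrix G r \<sigma> \<rho> $$ (i, j)},
       tail = (\<lambda>(i, j, k). i),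
       head = (\<lambda>(i, j, k). j) \<rparr>"

text \<open>Components are maximal subquivers that are \<open>strongly_connected\<close>, respectively \<open>connected\<close>;
  the latter is the connectedness of the underlying undirected graph.\<close>

definition same_strong_component :: "('a, 'e) pre_digraph \<Rightarrow> 'a \<Rightarrow> 'a \<Rightarrow> bool" where
  "same_strong_component \<Gamma> u v \<longleftrightarrow>
     (\<exists>H. pre_digraph.max_subgraph \<Gamma> strongly_connected H \<and> u \<in> verts H \<and> v \<in> verts H)"

definition same_weak_component :: "('a, 'e) pre_digraph \<Rightarrow> 'a \<Rightarrow> 'a \<Rightarrow> bool" where
  "same_weak_component \<Gamma> u v \<longleftrightarrow>
     (\<exists>H. pre_digraph.max_subgraph \<Gamma> Digraph_Component.connected H \<and> u \<in> verts H \<and> v \<in> verts H)"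

definition multiples_on :: "'g set \<Rightarrow> ('g \<Rightarrow> complex) \<Rightarrow> ('g \<Rightarrow> complex) \<Rightarrow> bool" where
  "multiples_on N \<chi> \<psi> \<longleftrightarrow>
     (\<exists>c. \<forall>h\<in>N. \<chi> h = c * \<psi> h) \<and> (\<exists>c. \<forall>h\<in>N. \<psi> h = c * \<chi> h)"

end

theory Submission
  imports
    Defs
    "Jordan_Normal_Form.Spectral_Radius"
    "Jordan_Normal_Form.DL_Rank"
    "HOL-Algebra.Multiplicative_Group"
begin

text \<open>Everything is read off from the pairing \<open>\<langle>\<phi>, \<psi>\<rangle>\<^sub>N = \<Sum>\<^sub>h\<^sub>\<in>\<^sub>N \<phi>(h) \<psi>(h\<^sup>-\<^sup>1)\<close> of characters.
  Evaluating \<open>\<Sum>\<^sub>g \<Sum>\<^sub>h\<^sub>\<in>\<^sub>N \<chi>\<^sub>k(g x g\<^sup>-\<^sup>1 h) \<chi>\<^sub>i(h\<^sup>-\<^sup>1)\<close> in two ways by Schur's lemma shows that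
  \<open>\<langle>\<chi>\<^sub>k, \<chi>\<^sub>i\<rangle>\<^sub>N \<noteq> 0\<close> forces \<open>\<chi>\<^sub>k / d\<^sub>k = \<chi>\<^sub>i / d\<^sub>i\<close> on \<open>N\<close>.
  Since \<open>\<rho>\<close> is trivial on \<open>N\<close>, an arc from \<open>i\<close> to \<open>j\<close> gives \<open>\<langle>\<chi>\<^sub>i, \<chi>\<^sub>j\<rangle>\<^sub>N \<noteq> 0\<close>, and being multiples on
  \<open>N\<close> is an equivalence relation. Conversely, the character of \<open>\<rho>\<close> takes the value \<open>n\<close> exactly on \<open>N\<close>,
  hence \<open>1\<^sub>N\<close> is a polynomial in it and \<open>1\<^sub>N \<chi>\<^sub>i\<close> is a combination of the characters
  reachable from \<open>i\<close>; so if \<open>j\<close> is not reachable, then \<open>\<langle>\<chi>\<^sub>i, \<chi>\<^sub>j\<rangle>\<^sub>N = 0\<close>.\<close>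

section \<open>Matrices\<close>

text \<open>Schur's lemma is applied to \<open>G\<close> alone: averaging over the conjugates of an
  element of \<open>N\<close> compares characters on \<open>N\<close> without decomposing their
  restrictions. The pairing uses inverses instead of complex conjugates, so it is bilinear and comes
  straight out of Schur averages. Conjugates enter only to show that a character pairs nontrivially
  with itself on \<open>N\<close>, through eigenvalues that are roots of unity. Strong and weak
  components agree because the relation of being multiples is symmetric: it yields directed paths
  both ways. Complete reducibility is there for the quiver itself. The McKay matrix is a definite
  description, so before any arc can be used, a decomposition of \<rho> \<otimes> \<sigma> must be
  shown to exist (Maschke) and to be unique (orthogonality). As representations are families of
  matrices, both are done with explicit block matrices. Degree \<open>n = 0\<close> is covered
  uniformly: then \<open>N\<close> is all of \<open>G\<close>, there are no arcs, and the polynomial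
  in the character of \<rho> is the empty product.\<close>

text \<open>Matrices of all sizes share one type, so there is no common zero to start a sum from.
  The size is therefore an argument and the sum is taken entrywise.\<close>

definition mat_sum :: "nat \<Rightarrow> nat \<Rightarrow> ('i \<Rightarrow> complex mat) \<Rightarrow> 'i set \<Rightarrow> complex mat" where
  "mat_sum m k f S = mat m k (\<lambda>(i, j). \<Sum>s\<in>S. f s $$ (i, j))"

lemma mat_sum_carrier [simp]: "mat_sum m k f S \<in> carrier_mat m k"
  by (simp add: mat_sum_def)

lemma mat_sum_cong:
  assumes "\<And>s. s \<in> S \<Longrightarrow> f s = h s"
  shows "mat_sum m k f S = mat_sum m k h S"
  using assms by (auto simp: mat_sum_def)

lemma mat_sum_reindex:
  assumes "bij_betw \<phi> S T"
  shows "mat_sum m k f T = mat_sum m k (\<lambda>s. f (\<phi> s)) S"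
  unfolding mat_sum_def
  by (intro eq_matI) (simp_all add: sum.reindex_bij_betw [OF assms, symmetric])

lemma mult_mat_index:
  assumes "A \<in> carrier_mat m k" "B \<in> carrier_mat k l" "i < m" "j < l"
  shows "(A * B) $$ (i, j) = (\<Sum>p<k. A $$ (i, p) * B $$ (p, j))"
  using assms by (simp add: scalar_prod_def atLeast0LessThan)

lemma mult_mat_sum:
  assumes "A \<in> carrier_mat l m" "\<And>s. s \<in> S \<Longrightarrow> f s \<in> carrier_mat m k"
  shows "A * mat_sum m k f S = mat_sum l k (\<lambda>s. A * f s) S"
proof (rule eq_matI)
  fix i j assume "i < dim_row (mat_sum l k (\<lambda>s. A * f s) S)" "j < dim_col (mat_sum l k (\<lambda>s. A * f s) S)"
  then have ij: "i < l" "j < k" by (auto simp: mat_sum_def)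
  have "(A * mat_sum m k f S) $$ (i, j) = (\<Sum>p<m. \<Sum>s\<in>S. A $$ (i, p) * f s $$ (p, j))"
    using assms(1) ij
    by (simp add: mat_sum_def scalar_prod_def sum_distrib_left atLeast0LessThan)
  also have "\<dots> = (\<Sum>s\<in>S. \<Sum>p<m. A $$ (i, p) * f s $$ (p, j))"
    by (rule sum.swap)
  also have "\<dots> = (\<Sum>s\<in>S. (A * f s) $$ (i, j))"
    by (intro sum.cong refl mult_mat_index [OF assms(1) assms(2) ij, symmetric])
  finally show "(A * mat_sum m k f S) $$ (i, j) = mat_sum l k (\<lambda>s. A * f s) S $$ (i, j)"
    using ij by (simp add: mat_sum_def)
qed (use assms in \<open>auto simp: mat_sum_def\<close>)

lemma mat_sum_mult:
  assumes "B \<in> carrier_mat k l" "\<And>s. s \<in> S \<Longrightarrow> f s \<in> carrier_mat m k"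
  shows "mat_sum m k f S * B = mat_sum m l (\<lambda>s. f s * B) S"
proof (rule eq_matI)
  fix i j assume "i < dim_row (mat_sum m l (\<lambda>s. f s * B) S)" "j < dim_col (mat_sum m l (\<lambda>s. f s * B) S)"
  then have ij: "i < m" "j < l" by (auto simp: mat_sum_def)
  have "(mat_sum m k f S * B) $$ (i, j) = (\<Sum>p<k. \<Sum>s\<in>S. f s $$ (i, p) * B $$ (p, j))"
    using assms(1) ij
    by (simp add: mat_sum_def scalar_prod_def sum_distrib_right atLeast0LessThan)
  also have "\<dots> = (\<Sum>s\<in>S. \<Sum>p<k. f s $$ (i, p) * B $$ (p, j))"
    by (rule sum.swap)
  also have "\<dots> = (\<Sum>s\<in>S. (f s * B) $$ (i, j))"
    by (intro sum.cong refl mult_mat_index [OF assms(2) assms(1) ij, symmetric])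
  finally show "(mat_sum m k f S * B) $$ (i, j) = mat_sum m l (\<lambda>s. f s * B) S $$ (i, j)"
    using ij by (simp add: mat_sum_def)
qed (use assms in \<open>auto simp: mat_sum_def\<close>)

section \<open>Traces, and their invariance under similarity\<close>

definition mat_trace :: "complex mat \<Rightarrow> complex" where
  "mat_trace A = (\<Sum>k<dim_row A. A $$ (k, k))"

lemma character_eq_trace: "character \<rho> g = mat_trace (\<rho> g)"
  by (simp add: character_def mat_trace_def)

lemma mat_trace_one [simp]: "mat_trace (1\<^sub>m n) = of_nat n"
  by (simp add: mat_trace_def)

lemma mat_trace_smult: "A \<in> carrier_mat n n \<Longrightarrow> mat_trace (c \<cdot>\<^sub>m A) = c * mat_trace A"
  by (auto simp: mat_trace_def sum_distrib_left)

lemma mat_trace_mult: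
  assumes "A \<in> carrier_mat m k" "B \<in> carrier_mat k m"
  shows "mat_trace (A * B) = (\<Sum>i<m. \<Sum>p<k. A $$ (i, p) * B $$ (p, i))"
  using assms by (auto simp: mat_trace_def scalar_prod_def atLeast0LessThan intro!: sum.cong)

lemma mat_trace_comm:
  assumes "A \<in> carrier_mat m k" "B \<in> carrier_mat k m"
  shows "mat_trace (A * B) = mat_trace (B * A)"
  unfolding mat_trace_mult [OF assms] mat_trace_mult [OF assms(2,1)]
  by (subst sum.swap) (simp add: mult.commute)

lemma mat_trace_sum:
  assumes "\<And>s. s \<in> S \<Longrightarrow> f s \<in> carrier_mat m m"
  shows "mat_trace (mat_sum m m f S) = (\<Sum>s\<in>S. mat_trace (f s))"
proof -
  have "mat_trace (mat_sum m m f S) = (\<Sum>k<m. \<Sum>s\<in>S. f s $$ (k, k))"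
    by (simp add: mat_trace_def mat_sum_def)
  also have "\<dots> = (\<Sum>s\<in>S. \<Sum>k<m. f s $$ (k, k))" by (rule sum.swap)
  also have "\<dots> = (\<Sum>s\<in>S. mat_trace (f s))"
    using assms by (intro sum.cong refl) (auto simp: mat_trace_def)
  finally show ?thesis .
qed

lemma mat_trace_similar:
  assumes "similar_mat_wit A B P Q"
  shows "mat_trace A = mat_trace B"
proof -
  note D = similar_mat_witD [OF refl assms]
  have "mat_trace A = mat_trace (P * B * Q)" by (subst D(3)) simp
  also have "\<dots> = mat_trace (Q * (P * B))"
    using D(5-7) by (intro mat_trace_comm [where m = "dim_row A" and k = "dim_row A"]) auto
  also have "Q * (P * B) = Q * P * B"
    by (rule assoc_mult_mat [OF D(7,6,5), symmetric])
  also have "\<dots> = B" unfolding D(2) by (rule left_mult_one_mat [OF D(5)])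
  finally show ?thesis .
qed

lemma mat_trace_four_block:
  assumes "A \<in> carrier_mat m m" "D \<in> carrier_mat k k"
  shows "mat_trace (four_block_mat A B C D) = mat_trace A + mat_trace D"
proof -
  have eq: "{..<m + k} = {..<m} \<union> (\<lambda>i. i + m) ` {..<k}"
  proof (intro equalityI subsetI)
    fix i assume "i \<in> {..<m + k}"
    then show "i \<in> {..<m} \<union> (\<lambda>i. i + m) ` {..<k}"
      by (cases "i < m") (auto intro: image_eqI [where x = "i - m"])
  qed auto
  have "mat_trace (four_block_mat A B C D) =
      (\<Sum>i\<in>{..<m + k}. if i < m then A $$ (i, i) else D $$ (i - m, i - m))"
    using assms unfolding mat_trace_def by (intro sum.cong) auto
  also have "\<dots> = (\<Sum>i<m. A $$ (i, i)) + (\<Sum>i<k. D $$ (i, i))"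
    unfolding eq by (subst sum.union_disjoint) (auto simp: sum.reindex inj_on_def)
  finally show ?thesis using assms by (simp add: mat_trace_def)
qed

section \<open>Kronecker products\<close>

text \<open>The range is cut into \<open>m\<close> consecutive blocks of length \<open>k\<close>,
  and within a block the quotient is constant. This turns a sum over the indices of a Kronecker
  product into a double sum.\<close>

lemma sum_div_mod:
  fixes f :: "nat \<Rightarrow> nat \<Rightarrow> 'a :: comm_monoid_add"
  shows "(\<Sum>p<m * k. f (p div k) (p mod k)) = (\<Sum>a<m. \<Sum>b<k. f a b)"
proof -
  have "(\<Sum>p<m * k. f (p div k) (p mod k)) =
      (\<Sum>a<m. \<Sum>p\<in>{a * k..<a * k + k}. f (p div k) (p mod k))"
    by (rule sum.nat_group [symmetric])
  also have "\<dots> = (\<Sum>a<m. \<Sum>b<k. f a b)"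
  proof (rule sum.cong [OF refl])
    fix a
    have "(\<Sum>p\<in>{a * k..<a * k + k}. f (p div k) (p mod k)) =
        (\<Sum>b\<in>{0..<k}. f ((b + a * k) div k) ((b + a * k) mod k))"
      using sum.shift_bounds_nat_ivl [of "\<lambda>p. f (p div k) (p mod k)" 0 "a * k" k]
      by (simp add: add.commute)
    also have "\<dots> = (\<Sum>b<k. f a b)"
      unfolding atLeast0LessThan by (intro sum.cong) auto
    finally show "(\<Sum>p\<in>{a * k..<a * k + k}. f (p div k) (p mod k)) = (\<Sum>b<k. f a b)" .
  qed
  finally show ?thesis .
qed

lemma kronecker_carrier:
  assumes "A \<in> carrier_mat m m" "B \<in> carrier_mat k k"
  shows "kronecker A B \<in> carrier_mat (m * k) (m * k)"
  using assms by (auto simp: kronecker_def)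

lemma div_mod_less:
  fixes i :: nat assumes "i < m * k" shows "i div k < m" "i mod k < k"
  using assms by (auto simp: less_mult_imp_div_less) (cases k; simp)

lemma kronecker_index:
  assumes "A \<in> carrier_mat m m" "B \<in> carrier_mat k k" "i < m * k" "j < m * k"
  shows "kronecker A B $$ (i, j) = A $$ (i div k, j div k) * B $$ (i mod k, j mod k)"
  using assms by (auto simp: kronecker_def)

text \<open>The mixed-product rule, which makes the tensor product of representations
  multiplicative.\<close>

lemma mult_kronecker:
  assumes A: "A \<in> carrier_mat m m" "A' \<in> carrier_mat m m"
    and B: "B \<in> carrier_mat k k" "B' \<in> carrier_mat k k"
  shows "kronecker A B * kronecker A' B' = kronecker (A * A') (B * B')"
proof (rule eq_matI)
  have AB: "A * A' \<in> carrier_mat m m" "B * B' \<in> carrier_mat k k" using A B by auto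
  note c = kronecker_carrier [OF A(1) B(1)] kronecker_carrier [OF A(2) B(2)]
    kronecker_carrier [OF AB]
  show "dim_row (kronecker A B * kronecker A' B') = dim_row (kronecker (A * A') (B * B'))"
    "dim_col (kronecker A B * kronecker A' B') = dim_col (kronecker (A * A') (B * B'))"
    using c by auto
  fix i j assume "i < dim_row (kronecker (A * A') (B * B'))" "j < dim_col (kronecker (A * A') (B * B'))"
  then have ij: "i < m * k" "j < m * k" using c by auto
  note dm = div_mod_less [OF ij(1)] div_mod_less [OF ij(2)]
  have "(kronecker A B * kronecker A' B') $$ (i, j) =
      (\<Sum>p<m * k. (A $$ (i div k, p div k) * B $$ (i mod k, p mod k)) *
        (A' $$ (p div k, j div k) * B' $$ (p mod k, j mod k)))"
    unfolding mult_mat_index [OF c(1,2) ij]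
    using ij A B by (intro sum.cong refl) (simp add: kronecker_index)
  also have "\<dots> = (\<Sum>a<m. \<Sum>b<k. (A $$ (i div k, a) * B $$ (i mod k, b)) *
        (A' $$ (a, j div k) * B' $$ (b, j mod k)))"
    by (rule sum_div_mod [of "\<lambda>a b. (A $$ (i div k, a) * B $$ (i mod k, b)) *
        (A' $$ (a, j div k) * B' $$ (b, j mod k))"])
  also have "\<dots> = (A * A') $$ (i div k, j div k) * (B * B') $$ (i mod k, j mod k)"
    unfolding mult_mat_index [OF A dm(1,3)] mult_mat_index [OF B dm(2,4)] sum_product
    by (intro sum.cong refl) (simp add: mult_ac)
  also have "\<dots> = kronecker (A * A') (B * B') $$ (i, j)"
    by (rule kronecker_index [OF AB ij, symmetric])
  finally show "(kronecker A B * kronecker A' B') $$ (i, j) = kronecker (A * A') (B * B') $$ (i, j)" .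
qed

lemma mat_trace_kronecker:
  assumes "A \<in> carrier_mat m m" "B \<in> carrier_mat k k"
  shows "mat_trace (kronecker A B) = mat_trace A * mat_trace B"
proof -
  have "mat_trace (kronecker A B) =
      (\<Sum>p<m * k. A $$ (p div k, p div k) * B $$ (p mod k, p mod k))"
    using kronecker_carrier [OF assms]
    by (auto simp: mat_trace_def kronecker_index [OF assms] intro!: sum.cong)
  also have "\<dots> = (\<Sum>a<m. \<Sum>b<k. A $$ (a, a) * B $$ (b, b))"
    by (rule sum_div_mod [of "\<lambda>a b. A $$ (a, a) * B $$ (b, b)"])
  finally show ?thesis using assms by (simp add: mat_trace_def sum_product)
qed

lemma kronecker_one: "kronecker (1\<^sub>m m) (1\<^sub>m k) = 1\<^sub>m (m * k)"
proof (rule eq_matI)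
  fix i j assume "i < dim_row (1\<^sub>m (m * k) :: complex mat)" "j < dim_col (1\<^sub>m (m * k) :: complex mat)"
  then have ij: "i < m * k" "j < m * k" by auto
  have "kronecker (1\<^sub>m m) (1\<^sub>m k) $$ (i, j) =
      (if i div k = j div k \<and> i mod k = j mod k then 1 else 0)"
    using ij div_mod_less [OF ij(1)] div_mod_less [OF ij(2)]
    by (simp add: kronecker_index [of _ m _ k])
  also have "\<dots> = (if i = j then 1 else 0)"
    by (metis div_mult_mod_eq)
  finally show "kronecker (1\<^sub>m m) (1\<^sub>m k) $$ (i, j) = 1\<^sub>m (m * k) $$ (i, j)"
    using ij by simp
qed (auto simp: kronecker_def)

section \<open>Representations as multiplicative families of matrices\<close>

lemma carrier_GL:
  "A \<in> carrier (GL n) \<longleftrightarrow>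
     A \<in> carrier_mat n n \<and> (\<exists>B\<in>carrier_mat n n. A * B = 1\<^sub>m n \<and> B * A = 1\<^sub>m n)"
  by (auto simp: GL_def units_of_def Units_def ring_mat_def)

lemma GL_simps: "x \<otimes>\<^bsub>GL n\<^esub> y = x * y" "\<one>\<^bsub>GL n\<^esub> = 1\<^sub>m n"
  by (auto simp: GL_def units_of_def ring_mat_def)

lemma group_GL: "group (GL n)"
proof -
  interpret ring "ring_mat TYPE(complex) n ()" by (rule ring_mat)
  show ?thesis unfolding GL_def by (rule units_group)
qed

text \<open>Invertibility comes from the value at \<open>inv g\<close>, which is the inverse matrix.
  The condition at the unit excludes degenerate multiplicative maps such as the zero map. New
  representations are recognised in this form.\<close>

lemma representation_iff:
  assumes "group G"
  shows "representation G n \<rho> \<longleftrightarrow>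
    (\<forall>g\<in>carrier G. \<rho> g \<in> carrier_mat n n) \<and>
    (\<forall>g\<in>carrier G. \<forall>h\<in>carrier G. \<rho> (g \<otimes>\<^bsub>G\<^esub> h) = \<rho> g * \<rho> h) \<and>
    \<rho> \<one>\<^bsub>G\<^esub> = 1\<^sub>m n"
proof -
  interpret G: group G by fact
  show ?thesis
  proof safe
    assume r: "representation G n \<rho>"
    then interpret group_hom G "GL n" \<rho>
      using group_GL assms by (simp add: group_hom_def group_hom_axioms_def representation_def)
    show "\<rho> \<one>\<^bsub>G\<^esub> = 1\<^sub>m n" using hom_one by (simp add: GL_simps)
    show "\<rho> g \<in> carrier_mat n n" if "g \<in> carrier G" for g
      using hom_closed [OF that] by (simp add: carrier_GL)
    show "\<rho> (g \<otimes>\<^bsub>G\<^esub> h) = \<rho> g * \<rho> h" if "g \<in> carrier G" "h \<in> carrier G" for g h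
      using hom_mult [OF that] by (simp add: GL_simps)
  next
    assume *: "\<forall>g\<in>carrier G. \<rho> g \<in> carrier_mat n n"
      "\<forall>g\<in>carrier G. \<forall>h\<in>carrier G. \<rho> (g \<otimes>\<^bsub>G\<^esub> h) = \<rho> g * \<rho> h"
      "\<rho> \<one>\<^bsub>G\<^esub> = 1\<^sub>m n"
    have "\<rho> g \<in> carrier (GL n)" if g: "g \<in> carrier G" for g
    proof -
      have "\<rho> g * \<rho> (inv\<^bsub>G\<^esub> g) = 1\<^sub>m n" "\<rho> (inv\<^bsub>G\<^esub> g) * \<rho> g = 1\<^sub>m n"
        using * g by (metis G.inv_closed G.r_inv, metis G.inv_closed G.l_inv)
      then show ?thesis using * g by (auto simp: carrier_GL)
    qed
    then show "representation G n \<rho>"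
      using * by (auto simp: representation_def hom_def GL_simps)
  qed
qed

section \<open>Schur's lemma\<close>

lemma (in group) representation_carrier:
  assumes "representation G n \<rho>" "g \<in> carrier G"
  shows "\<rho> g \<in> carrier_mat n n"
  using assms representation_iff [OF group_axioms] by blast

lemma (in group) representation_mult:
  assumes "representation G n \<rho>" "g \<in> carrier G" "h \<in> carrier G"
  shows "\<rho> (g \<otimes> h) = \<rho> g * \<rho> h"
  using assms representation_iff [OF group_axioms] by blast

lemma (in group) representation_one:
  assumes "representation G n \<rho>"
  shows "\<rho> \<one> = 1\<^sub>m n"
  using assms representation_iff [OF group_axioms] by blast

lemma (in group) representation_inv:
  assumes "representation G n \<rho>" "g \<in> carrier G"
  shows "\<rho> g * \<rho> (inv g) = 1\<^sub>m n" "\<rho> (inv g) * \<rho> g = 1\<^sub>m n"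
proof -
  show "\<rho> g * \<rho> (inv g) = 1\<^sub>m n"
    using representation_mult [OF assms(1,2) inv_closed [OF assms(2)]] assms
    by (simp add: representation_one)
  show "\<rho> (inv g) * \<rho> g = 1\<^sub>m n"
    using representation_mult [OF assms(1) inv_closed [OF assms(2)] assms(2)] assms
    by (simp add: representation_one)
qed

lemma irreducible_repD:
  assumes "irreducible_rep G n \<rho>"
  shows "representation G n \<rho>" "0 < n"
  using assms by (auto simp: irreducible_rep_def)

lemma subspace_vec_iff:
  "VectorSpace.subspace class_ring W (module_vec TYPE(complex) n) \<longleftrightarrow>
     W \<subseteq> carrier_vec n \<and> 0\<^sub>v n \<in> W \<and> (\<forall>v\<in>W. \<forall>w\<in>W. v + w \<in> W) \<and> (\<forall>c. \<forall>v\<in>W. c \<cdot>\<^sub>v v \<in> W)"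
  by (auto simp: VectorSpace.subspace_def submodule_def vec_vs vec_module module_vec_simps class_ring_simps)

lemma irreducible_invariant:
  assumes "irreducible_rep G n \<rho>"
    and "W \<subseteq> carrier_vec n" "0\<^sub>v n \<in> W"
    and "\<And>v w. v \<in> W \<Longrightarrow> w \<in> W \<Longrightarrow> v + w \<in> W" "\<And>c v. v \<in> W \<Longrightarrow> c \<cdot>\<^sub>v v \<in> W"
    and "\<And>g w. g \<in> carrier G \<Longrightarrow> w \<in> W \<Longrightarrow> \<rho> g *\<^sub>v w \<in> W"
  shows "W = {0\<^sub>v n} \<or> W = carrier_vec n"
  using assms by (auto simp: irreducible_rep_def subspace_vec_iff)

text \<open>Preimages of the unit vectors are the columns of a right inverse \<open>Q\<close>. Since
  \<open>T * (Q * T - 1)\<close> vanishes, injectivity kills every column of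
  \<open>Q * T - 1\<close>.\<close>

lemma bijective_mat_inverse:
  fixes T :: "complex mat"
  assumes T: "T \<in> carrier_mat m n"
    and inj: "\<And>v. v \<in> carrier_vec n \<Longrightarrow> T *\<^sub>v v = 0\<^sub>v m \<Longrightarrow> v = 0\<^sub>v n"
    and surj: "\<And>w. w \<in> carrier_vec m \<Longrightarrow> \<exists>v\<in>carrier_vec n. T *\<^sub>v v = w"
  obtains Q where "m = n" "Q \<in> carrier_mat n m" "T * Q = 1\<^sub>m m" "Q * T = 1\<^sub>m n"
proof -
  have "\<exists>f. \<forall>j<m. f j \<in> carrier_vec n \<and> T *\<^sub>v f j = unit_vec m j"
    by (intro choice allI) (use surj unit_vec_carrier in blast)
  then obtain f where f: "\<And>j. j < m \<Longrightarrow> f j \<in> carrier_vec n" "\<And>j. j < m \<Longrightarrow> T *\<^sub>v f j = unit_vec m j"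
    by blast
  define Q where "Q = mat_of_cols n (map f [0..<m])"
  have Q: "Q \<in> carrier_mat n m"
    unfolding Q_def using mat_of_cols_carrier(1) [of n "map f [0..<m]"] by simp
  have colQ: "col Q j = f j" if "j < m" for j
    unfolding Q_def using f(1) that by (subst col_mat_of_cols) auto
  have TQ: "T * Q = 1\<^sub>m m"
  proof (rule mat_col_eqI)
    fix j assume "j < dim_col (1\<^sub>m m :: complex mat)"
    then have j: "j < m" by simp
    show "col (T * Q) j = col (1\<^sub>m m) j"
      using col_mult2 [OF T Q j] j by (simp add: colQ f(2))
  qed (use T Q in auto)
  have QT1: "Q * T - 1\<^sub>m n \<in> carrier_mat n n" by (rule minus_carrier_mat) simp
  have QT: "Q * T \<in> carrier_mat n n" using T Q by simp
  have "T * (Q * T - 1\<^sub>m n) = T * (Q * T) - T * 1\<^sub>m n"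
    by (rule mult_minus_distrib_mat [OF T QT]) simp
  also have "\<dots> = 0\<^sub>m m n"
    using T Q by (simp add: assoc_mult_mat [OF T Q T, symmetric] TQ)
  finally have 0: "T * (Q * T - 1\<^sub>m n) = 0\<^sub>m m n" .
  have "Q * T = 1\<^sub>m n"
  proof (rule eq_matI)
    fix i j assume "i < dim_row (1\<^sub>m n :: complex mat)" "j < dim_col (1\<^sub>m n :: complex mat)"
    then have ij: "i < n" "j < n" by auto
    have "T *\<^sub>v col (Q * T - 1\<^sub>m n) j = 0\<^sub>v m"
      using col_mult2 [OF T QT1 ij(2)] ij by (simp add: 0)
    then have "col (Q * T - 1\<^sub>m n) j = 0\<^sub>v n"
      using inj [of "col (Q * T - 1\<^sub>m n) j"] col_carrier_vec [OF _ QT1] ij by simp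
    then have "(Q * T - 1\<^sub>m n) $$ (i, j) = 0"
      using ij QT1 by (metis carrier_matD index_col index_zero_vec(1))
    then show "(Q * T) $$ (i, j) = 1\<^sub>m n $$ (i, j)"
      using ij by simp
  qed (use T Q in auto)
  \<comment> \<open>Squareness is a trace count: the two products have equal trace and are
    identities of size \<open>m\<close> and \<open>n\<close>.\<close>
  moreover have "m = n"
    using mat_trace_comm [OF T Q] by (simp add: TQ calculation)
  ultimately show ?thesis using that Q TQ by blast
qed

lemma mult_mat_unit_vec:
  fixes A :: "complex mat"
  assumes "A \<in> carrier_mat m n" "j < n"
  shows "A *\<^sub>v unit_vec n j = col A j"
  using col_mult2 [of A m n "1\<^sub>m n" n j] assms by simp

text \<open>Kernel and image of an intertwiner are invariant subspaces. The kernel is proper because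
  \<open>T\<close> is nonzero, hence trivial; the image is then nonzero, hence everything. So
  \<open>T\<close> is invertible and is itself the change of basis.\<close>

lemma (in group) schur_iso:
  assumes \<rho>: "irreducible_rep G n \<rho>" and \<tau>: "irreducible_rep G m \<tau>"
    and T: "T \<in> carrier_mat m n" and comm: "\<And>g. g \<in> carrier G \<Longrightarrow> T * \<rho> g = \<tau> g * T"
    and nz: "T \<noteq> 0\<^sub>m m n"
  shows "rep_iso G \<tau> \<rho>"
proof -
  note \<rho>c = representation_carrier [OF irreducible_repD(1) [OF \<rho>]]
  note \<tau>c = representation_carrier [OF irreducible_repD(1) [OF \<tau>]]
  have act: "T *\<^sub>v (\<rho> g *\<^sub>v v) = \<tau> g *\<^sub>v (T *\<^sub>v v)" if "g \<in> carrier G" "v \<in> carrier_vec n" for g v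
    using assoc_mult_mat_vec [OF T \<rho>c that(2)] assoc_mult_mat_vec [OF \<tau>c T that(2)] comm that
    by simp
  define K where "K = {v \<in> carrier_vec n. T *\<^sub>v v = 0\<^sub>v m}"
  have "K = {0\<^sub>v n} \<or> K = carrier_vec n"
  proof (rule irreducible_invariant [OF \<rho>])
    fix g w assume g: "g \<in> carrier G" and w: "w \<in> K"
    then show "\<rho> g *\<^sub>v w \<in> K"
      using \<rho>c [OF g] \<tau>c [OF g] act [OF g] by (auto simp: K_def)
  qed (use T in \<open>auto simp: K_def mult_add_distrib_mat_vec [OF T] mult_mat_vec [OF T]\<close>)
  moreover have "K \<noteq> carrier_vec n"
  proof
    assume K: "K = carrier_vec n"
    have "col T j = 0\<^sub>v m" if "j < n" for j
    proof -
      have "unit_vec n j \<in> K" using K by simp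
      then show ?thesis using T that by (simp add: K_def mult_mat_unit_vec)
    qed
    then have "T = 0\<^sub>m m n"
      using T by (intro mat_col_eqI) auto
    then show False using nz by blast
  qed
  ultimately have K: "K = {0\<^sub>v n}" by blast
  define R where "R = (\<lambda>v. T *\<^sub>v v) ` carrier_vec n"
  have "R = {0\<^sub>v m} \<or> R = carrier_vec m"
  proof (rule irreducible_invariant [OF \<tau>])
    show "R \<subseteq> carrier_vec m" using T by (auto simp: R_def)
    show "0\<^sub>v m \<in> R"
      unfolding R_def using T by (intro image_eqI [of _ _ "0\<^sub>v n"]) auto
    show "v + w \<in> R" if "v \<in> R" "w \<in> R" for v w
      using that T mult_add_distrib_mat_vec [OF T, symmetric] by (auto simp: R_def)
    show "c \<cdot>\<^sub>v v \<in> R" if "v \<in> R" for c v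
      using that T mult_mat_vec [OF T, symmetric] by (auto simp: R_def)
    show "\<tau> g *\<^sub>v w \<in> R" if "g \<in> carrier G" "w \<in> R" for g w
      using that act [OF that(1), symmetric] \<rho>c [OF that(1)] by (auto simp: R_def)
  qed
  moreover have "R \<noteq> {0\<^sub>v m}"
  proof
    assume "R = {0\<^sub>v m}"
    then have "carrier_vec n = K" by (auto simp: R_def K_def)
    with K have "(carrier_vec n :: complex vec set) = {0\<^sub>v n}" by simp
    then have "unit_vec n 0 = (0\<^sub>v n :: complex vec)" by (metis singletonD unit_vec_carrier)
    then show False using irreducible_repD(2) [OF \<rho>]
      by (metis index_unit_vec(1) index_zero_vec(1) zero_neq_one)
  qed
  ultimately have R: "R = carrier_vec m" by blast
  obtain Q where Q: "m = n" "Q \<in> carrier_mat n m" "T * Q = 1\<^sub>m m" "Q * T = 1\<^sub>m n"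
  proof (rule bijective_mat_inverse [OF T])
    show "v = 0\<^sub>v n" if "v \<in> carrier_vec n" "T *\<^sub>v v = 0\<^sub>v m" for v
      using that K by (auto simp: K_def)
    show "\<exists>v\<in>carrier_vec n. T *\<^sub>v v = w" if "w \<in> carrier_vec m" for w
      using that R unfolding R_def by (metis imageE)
  qed
  have "similar_mat_wit (\<tau> g) (\<rho> g) T Q" if g: "g \<in> carrier G" for g
  proof (rule similar_mat_witI [of _ _ n])
    have "T * \<rho> g * Q = \<tau> g * (T * Q)"
      unfolding comm [OF g] by (rule assoc_mult_mat [OF \<tau>c [OF g] T Q(2)])
    also have "\<dots> = \<tau> g" unfolding Q(3) using \<tau>c [OF g] by simp
    finally show "\<tau> g = T * \<rho> g * Q" by simp
  qed (use T Q \<rho>c [OF g] \<tau>c [OF g] in auto)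
  then show ?thesis unfolding rep_iso_def by blast
qed

text \<open>Over the complex numbers and in positive degree \<open>T\<close> has an eigenvalue. Its
  eigenspace is invariant because \<open>T\<close> commutes with the action, and nonzero, so it is
  the whole space.\<close>

lemma (in group) schur_scalar:
  assumes \<rho>: "irreducible_rep G n \<rho>"
    and T: "T \<in> carrier_mat n n" and comm: "\<And>g. g \<in> carrier G \<Longrightarrow> T * \<rho> g = \<rho> g * T"
  obtains c where "T = c \<cdot>\<^sub>m 1\<^sub>m n"
proof -
  note \<rho>c = representation_carrier [OF irreducible_repD(1) [OF \<rho>]]
  obtain c where "eigenvalue T c"
    using spectrum_non_empty [OF T irreducible_repD(2) [OF \<rho>]] by (auto simp: spectrum_def)
  then obtain v where v: "v \<in> carrier_vec n" "v \<noteq> 0\<^sub>v n" "T *\<^sub>v v = c \<cdot>\<^sub>v v"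
    using T by (auto simp: eigenvalue_def eigenvector_def)
  define W where "W = {v \<in> carrier_vec n. T *\<^sub>v v = c \<cdot>\<^sub>v v}"
  have "W = {0\<^sub>v n} \<or> W = carrier_vec n"
  proof (rule irreducible_invariant [OF \<rho>])
    fix g w assume g: "g \<in> carrier G" and w: "w \<in> W"
    then have w: "w \<in> carrier_vec n" "T *\<^sub>v w = c \<cdot>\<^sub>v w" by (auto simp: W_def)
    have "T *\<^sub>v (\<rho> g *\<^sub>v w) = \<rho> g *\<^sub>v (T *\<^sub>v w)"
      using assoc_mult_mat_vec [OF T \<rho>c w(1)] assoc_mult_mat_vec [OF \<rho>c T w(1)] comm g by simp
    then show "\<rho> g *\<^sub>v w \<in> W"
      using \<rho>c [OF g] w by (auto simp: W_def mult_mat_vec [OF \<rho>c [OF g]])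
  qed (use T in \<open>auto simp: W_def mult_add_distrib_mat_vec [OF T] mult_mat_vec [OF T]
      smult_add_distrib_vec smult_smult_assoc mult.commute\<close>)
  with v have W: "W = carrier_vec n" by (auto simp: W_def)
  have "T = c \<cdot>\<^sub>m 1\<^sub>m n"
  proof (rule mat_col_eqI)
    fix j assume "j < dim_col (c \<cdot>\<^sub>m 1\<^sub>m n)"
    then have j: "j < n" by simp
    have "unit_vec n j \<in> W" using W by simp
    then have "col T j = c \<cdot>\<^sub>v unit_vec n j"
      using T j by (simp add: W_def mult_mat_unit_vec)
    then show "col T j = col (c \<cdot>\<^sub>m 1\<^sub>m n) j"
      using j by auto
  qed (use T in auto)
  then show ?thesis by (rule that)
qed

section \<open>Orthogonality of characters\<close>

text \<open>There is no division by the group order, which therefore reappears as a factor in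
  \<open>average_scalar\<close> and \<open>character_norm\<close>.\<close>

definition (in group) average ::
    "nat \<Rightarrow> nat \<Rightarrow> ('a \<Rightarrow> complex mat) \<Rightarrow> ('a \<Rightarrow> complex mat) \<Rightarrow> complex mat \<Rightarrow> complex mat" where
  "average m n \<tau> \<rho> X = mat_sum m n (\<lambda>g. \<tau> g * X * \<rho> (inv g)) (carrier G)"

text \<open>The usual inner product of characters without normalisation. The set \<open>S\<close> is
  a parameter because orthogonality is used on the whole group and proportionality on a normal
  subgroup.\<close>

definition (in group) char_form :: "'a set \<Rightarrow> ('a \<Rightarrow> complex) \<Rightarrow> ('a \<Rightarrow> complex) \<Rightarrow> complex" where
  "char_form S \<chi> \<psi> = (\<Sum>h\<in>S. \<chi> h * \<psi> (inv h))"

lemma (in group) bij_betw_mult_left: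
  assumes "subgroup S G" "a \<in> S"
  shows "bij_betw (\<lambda>x. a \<otimes> x) S S"
proof (rule bij_betw_byWitness [where f' = "\<lambda>x. inv a \<otimes> x"])
  interpret S: subgroup S G by fact
  show "\<forall>x\<in>S. inv a \<otimes> (a \<otimes> x) = x" "\<forall>x\<in>S. a \<otimes> (inv a \<otimes> x) = x"
    using assms(2) by (simp_all add: m_assoc [symmetric])
  show "(\<lambda>x. a \<otimes> x) ` S \<subseteq> S" "(\<lambda>x. inv a \<otimes> x) ` S \<subseteq> S"
    using assms(2) by auto
qed

lemma (in group) average_carrier [simp]: "average m n \<tau> \<rho> X \<in> carrier_mat m n"
  by (simp add: average_def)

text \<open>Replace the summation variable \<open>g\<close> by \<open>h \<otimes> g\<close>: on the
  left this produces the factor \<open>\<tau> h\<close>, and on the right the factor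
  \<open>\<rho> h\<close> cancels.\<close>

lemma (in group) average_intertwines:
  assumes \<tau>: "representation G m \<tau>" and \<rho>: "representation G n \<rho>"
    and X: "X \<in> carrier_mat m n" and h: "h \<in> carrier G"
  shows "average m n \<tau> \<rho> X * \<rho> h = \<tau> h * average m n \<tau> \<rho> X"
proof -
  note \<tau>c = representation_carrier [OF \<tau>] and \<rho>c = representation_carrier [OF \<rho>]
  have t: "\<tau> g * X * \<rho> (inv g) \<in> carrier_mat m n" if "g \<in> carrier G" for g
    by (rule mult_carrier_mat [OF mult_carrier_mat [OF \<tau>c [OF that] X] \<rho>c [OF inv_closed [OF that]]])
  have "average m n \<tau> \<rho> X * \<rho> h = mat_sum m n (\<lambda>g. \<tau> g * X * \<rho> (inv g) * \<rho> h) (carrier G)"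
    unfolding average_def by (rule mat_sum_mult [OF \<rho>c [OF h] t])
  also have "\<dots> = mat_sum m n (\<lambda>g. \<tau> (h \<otimes> g) * X * \<rho> (inv (h \<otimes> g)) * \<rho> h) (carrier G)"
    by (rule mat_sum_reindex [OF bij_betw_mult_left [OF subgroup_self h]])
  also have "\<dots> = mat_sum m n (\<lambda>g. \<tau> h * (\<tau> g * X * \<rho> (inv g))) (carrier G)"
  proof (rule mat_sum_cong)
    fix g assume g: "g \<in> carrier G"
    have 1: "\<rho> (inv (h \<otimes> g)) * \<rho> h = \<rho> (inv g)"
      using g h representation_mult [OF \<rho>, of "inv (h \<otimes> g)" h]
      by (simp add: inv_mult_group m_assoc)
    have "\<tau> (h \<otimes> g) * X * \<rho> (inv (h \<otimes> g)) * \<rho> h = \<tau> (h \<otimes> g) * X * (\<rho> (inv (h \<otimes> g)) * \<rho> h)"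
      using g h X \<tau>c [of "h \<otimes> g"] \<rho>c [of "inv (h \<otimes> g)"] \<rho>c [of h]
      by (intro assoc_mult_mat) auto
    also have "\<dots> = \<tau> h * \<tau> g * X * \<rho> (inv g)"
      unfolding 1 representation_mult [OF \<tau> h g] ..
    also have "\<dots> = \<tau> h * \<tau> g * (X * \<rho> (inv g))"
      using g h X \<tau>c [OF g] \<tau>c [OF h] \<rho>c [of "inv g"] by (intro assoc_mult_mat) auto
    also have "\<dots> = \<tau> h * (\<tau> g * (X * \<rho> (inv g)))"
      using g h X \<tau>c [OF g] \<tau>c [OF h] \<rho>c [of "inv g"] by (intro assoc_mult_mat) auto
    also have "\<tau> g * (X * \<rho> (inv g)) = \<tau> g * X * \<rho> (inv g)"
      using g h X \<tau>c [OF g] \<tau>c [OF h] \<rho>c [of "inv g"] by (intro assoc_mult_mat [symmetric]) auto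
    finally show "\<tau> (h \<otimes> g) * X * \<rho> (inv (h \<otimes> g)) * \<rho> h = \<tau> h * (\<tau> g * X * \<rho> (inv g))" .
  qed
  also have "\<dots> = \<tau> h * average m n \<tau> \<rho> X"
    unfolding average_def by (rule mult_mat_sum [OF \<tau>c [OF h] t, symmetric])
  finally show ?thesis .
qed

text \<open>By Schur the average is a scalar matrix, and the trace determines the scalar: every
  summand is conjugate to \<open>X\<close>, so the trace of the average is the group order times
  that of \<open>X\<close>.\<close>

lemma (in group) average_scalar:
  assumes \<rho>: "irreducible_rep G n \<rho>" and X: "X \<in> carrier_mat n n"
  shows "average n n \<rho> \<rho> X = (of_nat (card (carrier G)) * mat_trace X / of_nat n) \<cdot>\<^sub>m 1\<^sub>m n"
proof -
  note r = irreducible_repD [OF \<rho>] note c = representation_carrier [OF r(1)]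
  obtain a where a: "average n n \<rho> \<rho> X = a \<cdot>\<^sub>m 1\<^sub>m n"
    by (rule schur_scalar [OF \<rho> average_carrier average_intertwines [OF r(1) r(1) X]])
  have "mat_trace (\<rho> g * X * \<rho> (inv g)) = mat_trace X" if g: "g \<in> carrier G" for g
  proof -
    have "mat_trace (\<rho> g * X * \<rho> (inv g)) = mat_trace (\<rho> (inv g) * (\<rho> g * X))"
      using c [OF g] c [of "inv g"] X g by (intro mat_trace_comm [where m = n and k = n]) auto
    also have "\<rho> (inv g) * (\<rho> g * X) = \<rho> (inv g) * \<rho> g * X"
      using g by (intro assoc_mult_mat [OF c c X, symmetric]) auto
    also have "\<dots> = X" unfolding representation_inv [OF r(1) g] using X by simp
    finally show ?thesis .
  qed
  moreover have "\<rho> g * X * \<rho> (inv g) \<in> carrier_mat n n" if "g \<in> carrier G" for g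
    by (rule mult_carrier_mat [OF mult_carrier_mat [OF c [OF that] X] c [OF inv_closed [OF that]]])
  ultimately have "mat_trace (average n n \<rho> \<rho> X) = of_nat (card (carrier G)) * mat_trace X"
    unfolding average_def by (subst mat_trace_sum) auto
  then have "a * of_nat n = of_nat (card (carrier G)) * mat_trace X"
    unfolding a by (subst (asm) mat_trace_smult [where n = n]) auto
  then have "a = of_nat (card (carrier G)) * mat_trace X / of_nat n"
    using r(2) by (simp add: field_simps)
  then show ?thesis unfolding a by simp
qed

text \<open>Multiplying by an elementary matrix isolates one diagonal entry of each factor. Products
  of traces thereby become sums of entries of averages.\<close>

lemma mult_single_entry_mult:
  fixes A B :: "complex mat"
  assumes A: "A \<in> carrier_mat m m" and B: "B \<in> carrier_mat n n" and "p < m" "q < n"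
  shows "(A * mat m n (\<lambda>ij. if ij = (p, q) then 1 else 0) * B) $$ (p, q) = A $$ (p, p) * B $$ (q, q)"
proof -
  let ?E = "mat m n (\<lambda>ij. if ij = (p, q) then 1 else 0 :: complex)"
  have E: "?E \<in> carrier_mat m n" by simp
  have AE: "A * ?E \<in> carrier_mat m n" using A E by simp
  have "(A * ?E) $$ (p, b) = (if b = q then A $$ (p, p) else 0)" if "b < n" for b
  proof -
    have "(A * ?E) $$ (p, b) = (\<Sum>a<m. A $$ (p, a) * ?E $$ (a, b))"
      by (rule mult_mat_index [OF A E \<open>p < m\<close> that])
    also have "\<dots> = (\<Sum>a<m. if a = p then (if b = q then A $$ (p, p) else 0) else 0)"
      using that by (intro sum.cong) auto
    finally show ?thesis using \<open>p < m\<close> by simp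
  qed
  then have "(A * ?E * B) $$ (p, q) = (\<Sum>b<n. (if b = q then A $$ (p, p) else 0) * B $$ (b, q))"
    unfolding mult_mat_index [OF AE B \<open>p < m\<close> \<open>q < n\<close>] by (intro sum.cong) auto
  also have "\<dots> = (\<Sum>b<n. if b = q then A $$ (p, p) * B $$ (b, q) else 0)"
    by (intro sum.cong) auto
  finally show ?thesis using \<open>q < n\<close> by simp
qed

text \<open>Both traces are expanded into diagonal entries; each product of a \<open>p\<close>-th
  and a \<open>q\<close>-th diagonal entry is an entry of
  \<open>\<tau> g * E * \<rho> (inv g)\<close> with \<open>E\<close> the elementary matrix at
  \<open>(p, q)\<close>.\<close>

lemma (in group) char_form_eq_average:
  assumes \<tau>: "representation G m \<tau>" and \<rho>: "representation G n \<rho>"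
  shows "char_form (carrier G) (character \<tau>) (character \<rho>) =
    (\<Sum>p<m. \<Sum>q<n. average m n \<tau> \<rho> (mat m n (\<lambda>ij. if ij = (p, q) then 1 else 0)) $$ (p, q))"
proof -
  note \<tau>c = representation_carrier [OF \<tau>] and \<rho>c = representation_carrier [OF \<rho>]
  have "char_form (carrier G) (character \<tau>) (character \<rho>) =
      (\<Sum>g\<in>carrier G. \<Sum>p<m. \<Sum>q<n. \<tau> g $$ (p, p) * \<rho> (inv g) $$ (q, q))"
    unfolding char_form_def character_def sum_product
    using carrier_matD [OF \<tau>c] carrier_matD [OF \<rho>c] by (intro sum.cong) auto
  also have "\<dots> = (\<Sum>p<m. \<Sum>g\<in>carrier G. \<Sum>q<n. \<tau> g $$ (p, p) * \<rho> (inv g) $$ (q, q))"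
    by (rule sum.swap)
  also have "\<dots> = (\<Sum>p<m. \<Sum>q<n. \<Sum>g\<in>carrier G. \<tau> g $$ (p, p) * \<rho> (inv g) $$ (q, q))"
    by (intro sum.cong refl sum.swap)
  also have "\<dots> = (\<Sum>p<m. \<Sum>q<n. average m n \<tau> \<rho> (mat m n (\<lambda>ij. if ij = (p, q) then 1 else 0)) $$ (p, q))"
    unfolding average_def mat_sum_def
    using mult_single_entry_mult [OF \<tau>c \<rho>c] by (intro sum.cong refl) simp
  finally show ?thesis .
qed

lemma (in group) character_orthogonal:
  assumes \<tau>: "irreducible_rep G m \<tau>" and \<rho>: "irreducible_rep G n \<rho>"
    and "\<not> rep_iso G \<tau> \<rho>"
  shows "char_form (carrier G) (character \<tau>) (character \<rho>) = 0"
proof -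
  have "average m n \<tau> \<rho> X = 0\<^sub>m m n" if "X \<in> carrier_mat m n" for X
    using schur_iso [OF \<rho> \<tau> average_carrier average_intertwines] that assms(3)
      irreducible_repD(1) [OF \<tau>] irreducible_repD(1) [OF \<rho>] by blast
  then show ?thesis
    unfolding char_form_eq_average [OF irreducible_repD(1) [OF \<tau>] irreducible_repD(1) [OF \<rho>]]
    by simp
qed

lemma (in group) character_norm:
  assumes \<rho>: "irreducible_rep G n \<rho>"
  shows "char_form (carrier G) (character \<rho>) (character \<rho>) = of_nat (card (carrier G))"
proof -
  note r = irreducible_repD [OF \<rho>]
  let ?E = "\<lambda>p q. mat n n (\<lambda>ij. if ij = (p, q) then 1 else 0 :: complex)"
  \<comment> \<open>Off-diagonal elementary matrices have trace zero and average to zero. The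
    \<open>n\<close> diagonal ones contribute the group order divided by \<open>n\<close>
    each.\<close>
  have tr: "mat_trace (?E p q) = (if p = q then 1 else 0)" if "p < n" for p q
  proof -
    have "mat_trace (?E p q) = (\<Sum>k<n. if k = p then (if p = q then 1 else 0) else 0)"
      by (auto simp: mat_trace_def intro!: sum.cong)
    then show ?thesis using that by simp
  qed
  have "average n n \<rho> \<rho> (?E p q) $$ (p, q) = (if q = p then of_nat (card (carrier G)) / of_nat n else 0)"
    if "p < n" "q < n" for p q
    using that by (simp add: average_scalar [OF \<rho>] tr)
  then have "char_form (carrier G) (character \<rho>) (character \<rho>) =
      (\<Sum>p<n. \<Sum>q<n. if q = p then of_nat (card (carrier G)) / of_nat n else 0)"
    unfolding char_form_eq_average [OF r(1) r(1)] by (intro sum.cong refl) auto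
  then show ?thesis using r(2) by simp
qed

lemma (in group) character_cyclic:
  assumes "representation G n \<rho>" "g \<in> carrier G" "h \<in> carrier G"
  shows "character \<rho> (g \<otimes> h) = character \<rho> (h \<otimes> g)"
  unfolding character_eq_trace
  using representation_mult [OF assms(1)] representation_carrier [OF assms(1)] assms(2,3)
  by (simp add: mat_trace_comm [where m = n and k = n])

section \<open>Sums over conjugates and proportionality of characters on a normal subgroup\<close>

text \<open>The matrices of the conjugates of \<open>x\<close> sum to the average of
  \<open>\<rho> x\<close>, a known scalar. Multiplying by \<open>\<rho> h\<close> and taking traces
  gives the formula.\<close>

lemma (in group) sum_character_conjugates:
  assumes \<rho>: "irreducible_rep G n \<rho>" and x: "x \<in> carrier G" and h: "h \<in> carrier G"
  shows "(\<Sum>g\<in>carrier G. character \<rho> (g \<otimes> x \<otimes> inv g \<otimes> h)) =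
    of_nat (card (carrier G)) * character \<rho> x / of_nat n * character \<rho> h"
proof -
  note r = irreducible_repD [OF \<rho>] note c = representation_carrier [OF r(1)]
  have t: "\<rho> g * \<rho> x * \<rho> (inv g) \<in> carrier_mat n n" if "g \<in> carrier G" for g
    using c [OF that] c [OF x] c [of "inv g"] that by simp
  have "(\<Sum>g\<in>carrier G. character \<rho> (g \<otimes> x \<otimes> inv g \<otimes> h)) =
      (\<Sum>g\<in>carrier G. mat_trace (\<rho> g * \<rho> x * \<rho> (inv g) * \<rho> h))"
    using x h by (simp add: character_eq_trace representation_mult [OF r(1)])
  also have "\<dots> = mat_trace (mat_sum n n (\<lambda>g. \<rho> g * \<rho> x * \<rho> (inv g) * \<rho> h) (carrier G))"
    by (rule mat_trace_sum [symmetric]) (rule mult_carrier_mat [OF t c [OF h]])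
  also have "\<dots> = mat_trace (average n n \<rho> \<rho> (\<rho> x) * \<rho> h)"
    unfolding average_def by (subst mat_sum_mult [OF c [OF h] t]) auto
  also have "\<dots> = mat_trace ((of_nat (card (carrier G)) * character \<rho> x / of_nat n) \<cdot>\<^sub>m \<rho> h)"
    unfolding average_scalar [OF \<rho> c [OF x]] character_eq_trace [of \<rho> x]
    using c [OF h] by (subst mult_smult_assoc_mat [where n = n and nc = n]) auto
  finally show ?thesis
    using c [OF h] by (simp add: mat_trace_smult character_eq_trace)
qed

text \<open>The conjugate of \<open>x\<close> can stand in the argument of either character. Summing
  over \<open>g\<close> produces the same pairing both times, with factor
  \<open>character \<tau> x / m\<close> in one case and \<open>character \<rho> x / n\<close> in the
  other, so a nonzero pairing can be cancelled.\<close>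

lemma (in group) character_proportional:
  assumes N: "N \<lhd> G" and x: "x \<in> N"
    and \<tau>: "irreducible_rep G m \<tau>" and \<rho>: "irreducible_rep G n \<rho>"
    and nz: "char_form N (character \<tau>) (character \<rho>) \<noteq> 0"
    and fin: "finite (carrier G)"
  shows "character \<tau> x / of_nat m = character \<rho> x / of_nat n"
proof -
  interpret N: normal N G by fact
  let ?t = "character \<tau>" and ?r = "character \<rho>" and ?G = "of_nat (card (carrier G)) :: complex"
  have G0: "?G \<noteq> 0" using fin one_closed by (auto simp: card_eq_0_iff)
  have xG: "x \<in> carrier G" using x N.subset by blast
  have NG: "h \<in> carrier G" if "h \<in> N" for h using that N.subset by blast
  let ?S = "\<Sum>g\<in>carrier G. \<Sum>h\<in>N. ?t (g \<otimes> x \<otimes> inv g \<otimes> h) * ?r (inv h)"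
  have "?S = (\<Sum>h\<in>N. \<Sum>g\<in>carrier G. ?t (g \<otimes> x \<otimes> inv g \<otimes> h) * ?r (inv h))"
    by (rule sum.swap)
  also have "\<dots> = (\<Sum>h\<in>N. ?G * ?t x / of_nat m * ?t h * ?r (inv h))"
    using NG by (intro sum.cong refl) (simp add: sum_distrib_right [symmetric] sum_character_conjugates [OF \<tau> xG])
  also have "\<dots> = ?G * ?t x / of_nat m * char_form N ?t ?r"
    by (simp add: char_form_def sum_distrib_left mult_ac)
  finally have 1: "?S = ?G * ?t x / of_nat m * char_form N ?t ?r" .
  have "?S = (\<Sum>g\<in>carrier G. \<Sum>h\<in>N. ?t h * ?r (g \<otimes> x \<otimes> inv g \<otimes> inv h))"
  proof (rule sum.cong [OF refl])
    fix g assume g: "g \<in> carrier G"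
    \<comment> \<open>Normality enters here: \<open>y\<close> stays in \<open>N\<close>, so left
      translation by \<open>y\<close> permutes \<open>N\<close> and carries \<open>y\<close> from
      the argument of the first character to that of the second.\<close>
    define y where "y = g \<otimes> x \<otimes> inv g"
    have y: "y \<in> N" unfolding y_def using N.inv_op_closed2 [OF g x] .
    have yG: "y \<in> carrier G" using NG y .
    have "(\<Sum>h\<in>N. ?t (y \<otimes> h) * ?r (inv h)) = (\<Sum>h\<in>N. ?t (y \<otimes> h) * ?r (y \<otimes> inv (y \<otimes> h)))"
    proof (intro sum.cong refl)
      fix h assume h: "h \<in> N"
      \<comment> \<open>The inverse of \<open>y \<otimes> h\<close> has the inverse of
        \<open>y\<close> on the right, so a cyclic shift under the trace is needed before it
        cancels.\<close>
      have "?r (y \<otimes> inv (y \<otimes> h)) = ?r (inv (y \<otimes> h) \<otimes> y)"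
        using irreducible_repD(1) [OF \<rho>] yG NG [OF h] by (intro character_cyclic) auto
      also have "inv (y \<otimes> h) \<otimes> y = inv h"
        using yG NG [OF h] by (simp add: inv_mult_group m_assoc)
      finally show "?t (y \<otimes> h) * ?r (inv h) = ?t (y \<otimes> h) * ?r (y \<otimes> inv (y \<otimes> h))" by simp
    qed
    also have "\<dots> = (\<Sum>h\<in>N. ?t h * ?r (y \<otimes> inv h))"
      by (rule sum.reindex_bij_betw [OF bij_betw_mult_left [OF N.subgroup_axioms y]])
    finally show "(\<Sum>h\<in>N. ?t (g \<otimes> x \<otimes> inv g \<otimes> h) * ?r (inv h)) =
        (\<Sum>h\<in>N. ?t h * ?r (g \<otimes> x \<otimes> inv g \<otimes> inv h))"
      by (simp add: y_def)
  qed
  also have "\<dots> = (\<Sum>h\<in>N. \<Sum>g\<in>carrier G. ?t h * ?r (g \<otimes> x \<otimes> inv g \<otimes> inv h))"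
    by (rule sum.swap)
  also have "\<dots> = (\<Sum>h\<in>N. ?t h * (?G * ?r x / of_nat n * ?r (inv h)))"
    using NG by (intro sum.cong refl)
      (simp add: sum_distrib_left [symmetric] sum_character_conjugates [OF \<rho> xG])
  also have "\<dots> = ?G * ?r x / of_nat n * char_form N ?t ?r"
    by (simp add: char_form_def sum_distrib_left mult_ac)
  finally have "?G * ?t x / of_nat m * char_form N ?t ?r = ?G * ?r x / of_nat n * char_form N ?t ?r"
    unfolding 1 .
  then have "(character \<tau> x / of_nat m) * (?G * char_form N ?t ?r) =
      (character \<rho> x / of_nat n) * (?G * char_form N ?t ?r)"
    by (simp add: mult_ac)
  then show ?thesis using nz G0 by (metis mult_cancel_right mult_eq_0_iff)
qed

section \<open>Matrices of finite order\<close>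

lemma upper_triangular_mult:
  fixes A B :: "complex mat"
  assumes A: "A \<in> carrier_mat n n" "upper_triangular A" and B: "B \<in> carrier_mat n n" "upper_triangular B"
  shows "upper_triangular (A * B)"
    and "i < n \<Longrightarrow> (A * B) $$ (i, i) = A $$ (i, i) * B $$ (i, i)"
proof -
  have A0: "A $$ (i, j) = 0" if "j < i" "i < n" for i j
    using A that by (auto intro: upper_triangularD)
  have B0: "B $$ (i, j) = 0" if "j < i" "i < n" for i j
    using B that by (auto intro: upper_triangularD)
  show "upper_triangular (A * B)"
  proof (rule upper_triangularI)
    fix i j assume "j < i" and "i < dim_row (A * B)"
    then have ij: "j < i" "i < n" "j < n" using A by auto
    have "A $$ (i, p) * B $$ (p, j) = 0" if "p < n" for p
      using A0 [of p i] B0 [of j p] ij that by (cases "p < i") auto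
    then show "(A * B) $$ (i, j) = 0"
      unfolding mult_mat_index [OF A(1) B(1) ij(2,3)] by (intro sum.neutral) blast
  qed
  show "(A * B) $$ (i, i) = A $$ (i, i) * B $$ (i, i)" if i: "i < n"
  proof -
    have "(A * B) $$ (i, i) = (\<Sum>p<n. A $$ (i, p) * B $$ (p, i))"
      by (rule mult_mat_index [OF A(1) B(1) i i])
    also have "\<dots> = (\<Sum>p<n. if p = i then A $$ (i, i) * B $$ (i, i) else 0)"
    proof (intro sum.cong refl)
      fix p assume "p \<in> {..<n}"
      then show "A $$ (i, p) * B $$ (p, i) = (if p = i then A $$ (i, i) * B $$ (i, i) else 0)"
        using A0 [of p i] B0 [of i p] i by (cases p i rule: linorder_cases) auto
    qed
    finally show ?thesis using i by simp
  qed
qed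

lemma upper_triangular_pow:
  fixes B :: "complex mat"
  assumes B: "B \<in> carrier_mat n n" "upper_triangular B"
  shows "upper_triangular (B ^\<^sub>m k) \<and> (\<forall>i<n. (B ^\<^sub>m k) $$ (i, i) = B $$ (i, i) ^ k)"
proof (induction k)
  case 0
  then show ?case using B by simp
next
  case (Suc k)
  have Bk: "B ^\<^sub>m k \<in> carrier_mat n n" using B by simp
  then show ?case
    using Suc upper_triangular_mult [OF Bk _ B] by (auto simp: mult.commute)
qed

text \<open>A triangular form exists over the complex numbers, and the diagonals of its powers are
  the powers of its diagonal. This gives the traces of all powers of \<open>A\<close> and makes the
  diagonal entries roots of unity.\<close>

lemma triangularize_finite_order:
  fixes A :: "complex mat"
  assumes A: "A \<in> carrier_mat n n" "A ^\<^sub>m m = 1\<^sub>m n" "0 < m"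
  obtains B P Q where "similar_mat_wit A B P Q" "B \<in> carrier_mat n n" "upper_triangular B"
    "B ^\<^sub>m m = 1\<^sub>m n" "\<And>i. i < n \<Longrightarrow> B $$ (i, i) ^ m = 1"
    "\<And>k. mat_trace (A ^\<^sub>m k) = (\<Sum>i<n. B $$ (i, i) ^ k)"
proof -
  obtain es where "char_poly A = (\<Prod>e\<leftarrow>es. [:- e, 1:])"
    using char_poly_factorized [OF A(1)] by blast
  from schur_decomposition_exists [OF A(1) this] obtain B
    where B: "B \<in> carrier_mat n n" "upper_triangular B" "similar_mat A B" by blast
  then obtain P Q where PQ: "similar_mat_wit A B P Q" by (auto simp: similar_mat_def)
  note D = similar_mat_witD2 [OF A(1) PQ]
  have "B ^\<^sub>m m = Q * A ^\<^sub>m m * P"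
    by (rule similar_mat_wit_pow_id [OF similar_mat_wit_sym [OF PQ]])
  then have Bm: "B ^\<^sub>m m = 1\<^sub>m n" using D A(2) by simp
  have "B $$ (i, i) ^ m = 1" if "i < n" for i
    using upper_triangular_pow [OF B(1,2), of m] Bm that by simp
  moreover have "mat_trace (A ^\<^sub>m k) = (\<Sum>i<n. B $$ (i, i) ^ k)" for k
    unfolding mat_trace_similar [OF similar_mat_wit_pow [OF PQ, of k]] unfolding mat_trace_def
    using upper_triangular_pow [OF B(1,2), of k] B(1) by (intro sum.cong) auto
  ultimately show ?thesis using that PQ B Bm by blast
qed

lemma norm_root_of_unity:
  fixes z :: complex
  assumes "z ^ m = 1" "0 < m"
  shows "norm z = 1"
  using power_eq_1_iff [OF assms(1)] assms(2) by simp

text \<open>The power \<open>m - 1\<close> is the inverse of \<open>A\<close>, and for a root of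
  unity inverse and conjugate coincide.\<close>

lemma trace_finite_order_inverse:
  fixes A :: "complex mat"
  assumes A: "A \<in> carrier_mat n n" "A ^\<^sub>m m = 1\<^sub>m n" "0 < m"
  shows "mat_trace (A ^\<^sub>m (m - 1)) = cnj (mat_trace A)"
proof -
  obtain B where B: "\<And>i. i < n \<Longrightarrow> B $$ (i, i) ^ m = 1"
    and tr: "\<And>k. mat_trace (A ^\<^sub>m k) = (\<Sum>i<n. B $$ (i, i) ^ k)"
    by (rule triangularize_finite_order [OF A]) blast
  have "z ^ (m - 1) = cnj z" if z: "z ^ m = 1" for z :: complex
  proof -
    have "z * z ^ (m - 1) = 1" using z A(3) by (simp add: power_eq_if)
    moreover have "z * cnj z = 1"
      using norm_root_of_unity [OF z A(3)] by (simp add: complex_norm_square [symmetric])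
    moreover have "z \<noteq> 0" using calculation by auto
    ultimately show ?thesis using mult_left_cancel [of z "z ^ (m - 1)" "cnj z"] by simp
  qed
  then show ?thesis
    using tr [of "m - 1"] tr [of 1] A(1) B by (simp add: cnj_sum)
qed

text \<open>Equality case of the triangle inequality: \<open>n\<close> numbers of modulus one with
  sum \<open>n\<close> are all one. Finite order then excludes nontrivial unipotent
  matrices.\<close>

lemma trace_finite_order_maximal:
  fixes A :: "complex mat"
  assumes A: "A \<in> carrier_mat n n" "A ^\<^sub>m m = 1\<^sub>m n" "0 < m" and tr: "mat_trace A = of_nat n"
  shows "A = 1\<^sub>m n"
proof -
  obtain B P Q where PQ: "similar_mat_wit A B P Q" and B: "B \<in> carrier_mat n n" "upper_triangular B"
    "B ^\<^sub>m m = 1\<^sub>m n" "\<And>i. i < n \<Longrightarrow> B $$ (i, i) ^ m = 1"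
    and trB: "\<And>k. mat_trace (A ^\<^sub>m k) = (\<Sum>i<n. B $$ (i, i) ^ k)"
    by (rule triangularize_finite_order [OF A]) blast
  have norm: "norm (B $$ (i, i)) = 1" if "i < n" for i
    using norm_root_of_unity [OF B(4) [OF that] A(3)] .
  have "(\<Sum>i<n. B $$ (i, i)) = of_nat n"
    using trB [of 1] tr A(1) by simp
  from arg_cong [OF this, of Re] have "(\<Sum>i<n. 1 - Re (B $$ (i, i))) = 0"
    by (simp add: sum_subtractf)
  moreover have le: "0 \<le> 1 - Re (B $$ (i, i))" if "i < n" for i
    using norm [OF that] complex_Re_le_cmod [of "B $$ (i, i)"] by simp
  ultimately have "1 - Re (B $$ (i, i)) = 0" if "i < n" for i
    using sum_nonneg_eq_0_iff [of "{..<n}" "\<lambda>i. 1 - Re (B $$ (i, i))"] that by auto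
  then have diag: "B $$ (i, i) = 1" if "i < n" for i
    using norm [OF that] that by (auto simp: complex_eq_iff cmod_def)
  \<comment> \<open>The sum of all powers of \<open>B\<close> is triangular with diagonal entries
    \<open>m\<close>, hence invertible. As \<open>B\<close> has order dividing \<open>m\<close>,
    multiplication by \<open>B\<close> only permutes the summands cyclically, so
    \<open>D * B = D\<close> and \<open>D\<close> can be cancelled.\<close>
  define D where "D = mat_sum n n (\<lambda>k. B ^\<^sub>m k) {..<m}"
  have D: "D \<in> carrier_mat n n" by (simp add: D_def)
  have Bk: "B ^\<^sub>m k \<in> carrier_mat n n" for k using B(1) by simp
  have "upper_triangular D"
  proof (rule upper_triangularI)
    fix i j assume "j < i" "i < dim_row D"
    then have ij: "j < i" "i < n" using D by auto
    then have "(B ^\<^sub>m k) $$ (i, j) = 0" for k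
      using upper_triangular_pow [OF B(1,2), of k] Bk [of k] by (auto intro: upper_triangularD)
    then show "D $$ (i, j) = 0" using ij by (simp add: D_def mat_sum_def)
  qed
  moreover have "D $$ (i, i) = of_nat m" if "i < n" for i
    using upper_triangular_pow [OF B(1,2)] that by (simp add: D_def mat_sum_def diag)
  then have "\<forall>i<n. D $$ (i, i) \<noteq> 0" using A(3) by simp
  ultimately have "det D \<noteq> 0"
    using upper_triangular_imp_det_eq_0_iff [OF D] D by (auto simp: diag_mat_def)
  then obtain D' where D': "D' \<in> carrier_mat n n" "D' * D = 1\<^sub>m n"
    using det_non_zero_imp_unit [OF D] by (auto simp: Units_def ring_mat_def)
  have "D * B = D"
  proof -
    have "D * B = mat_sum n n (\<lambda>k. B ^\<^sub>m Suc k) {..<m}"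
      unfolding D_def by (subst mat_sum_mult [OF B(1) Bk]) simp
    also have "\<dots> = D"
    proof -
      have "(\<Sum>k<m. (B ^\<^sub>m Suc k) $$ (i, j)) = (\<Sum>k<m. (B ^\<^sub>m k) $$ (i, j))" for i j
      proof -
        have "(\<Sum>k<Suc m. (B ^\<^sub>m k) $$ (i, j)) = (B ^\<^sub>m 0) $$ (i, j) + (\<Sum>k<m. (B ^\<^sub>m Suc k) $$ (i, j))"
          by (rule sum.lessThan_Suc_shift)
        moreover have "B ^\<^sub>m 0 = B ^\<^sub>m m" using B by simp
        ultimately show ?thesis by (simp del: pow_mat.simps)
      qed
      then show ?thesis by (simp add: D_def mat_sum_def)
    qed
    finally show ?thesis .
  qed
  then have "B = 1\<^sub>m n"
    using assoc_mult_mat [OF D'(1) D B(1)] D'(2) B(1) by simp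
  then show ?thesis
    using similar_mat_witD2 [OF A(1) PQ] by simp
qed

lemma (in group) representation_pow:
  assumes \<rho>: "representation G n \<rho>" and g: "g \<in> carrier G"
  shows "\<rho> (g [^] (k :: nat)) = \<rho> g ^\<^sub>m k"
proof (induction k)
  case 0
  show ?case using representation_carrier [OF \<rho> g] by (simp add: representation_one [OF \<rho>])
next
  case (Suc k)
  then show ?case using g by (simp add: representation_mult [OF \<rho>])
qed

lemma (in group) representation_finite_order:
  assumes \<rho>: "representation G n \<rho>" and g: "g \<in> carrier G"
  shows "\<rho> g ^\<^sub>m Coset.order G = 1\<^sub>m n"
  using representation_pow [OF assms, of "Coset.order G"] pow_order_eq_1 [OF g] representation_one [OF \<rho>]
  by simp

text \<open>The inverse of \<open>g\<close> is its power with exponent one less than the group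
  order, so the statement on matrices of finite order applies. It identifies
  \<open>char_form\<close> on characters with the Hermitian product.\<close>

lemma (in group) character_inv:
  assumes \<rho>: "representation G n \<rho>" and g: "g \<in> carrier G" and fin: "finite (carrier G)"
  shows "character \<rho> (inv g) = cnj (character \<rho> g)"
proof -
  have "0 < Coset.order G" using fin by (simp add: order_gt_0_iff_finite)
  have "inv g = g [^] (Coset.order G - 1)"
  proof (rule inv_equality)
    have "g [^] (Coset.order G - 1) \<otimes> g = g [^] Suc (Coset.order G - 1)" using g by simp
    then show "g [^] (Coset.order G - 1) \<otimes> g = \<one>" using \<open>0 < Coset.order G\<close> pow_order_eq_1 [OF g] by simp
  qed (use g in auto)
  then show ?thesis
    using trace_finite_order_inverse [OF representation_carrier [OF \<rho> g] representation_finite_order [OF \<rho> g] \<open>0 < Coset.order G\<close>]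
    by (simp add: character_eq_trace representation_pow [OF \<rho> g])
qed

text \<open>This makes the kernel of a representation visible in its character.\<close>

lemma (in group) character_eq_degree:
  assumes \<rho>: "representation G n \<rho>" and g: "g \<in> carrier G" and fin: "finite (carrier G)"
  shows "character \<rho> g = of_nat n \<longleftrightarrow> \<rho> g = 1\<^sub>m n"
proof
  assume "character \<rho> g = of_nat n"
  then show "\<rho> g = 1\<^sub>m n"
    using trace_finite_order_maximal [OF representation_carrier [OF \<rho> g] representation_finite_order [OF \<rho> g]]
      fin by (simp add: character_eq_trace order_gt_0_iff_finite)
qed (simp add: character_eq_trace)

text \<open>The form becomes a sum of squared absolute values, and the unit element alone
  contributes the square of the degree.\<close>

lemma (in group) char_form_self_nonzero:
  assumes \<rho>: "representation G n \<rho>" and n: "0 < n" and N: "subgroup N G" and fin: "finite (carrier G)"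
  shows "char_form N (character \<rho>) (character \<rho>) \<noteq> 0"
proof -
  interpret N: subgroup N G by fact
  have finN: "finite N" using N.subset fin finite_subset by blast
  have "char_form N (character \<rho>) (character \<rho>) = (\<Sum>h\<in>N. of_real ((norm (character \<rho> h))\<^sup>2))"
    unfolding char_form_def complex_norm_square using N.subset
    by (intro sum.cong refl) (auto simp: character_inv [OF \<rho> _ fin])
  also have "\<dots> = of_real (\<Sum>h\<in>N. (norm (character \<rho> h))\<^sup>2)" by simp
  finally have *: "char_form N (character \<rho>) (character \<rho>) = of_real (\<Sum>h\<in>N. (norm (character \<rho> h))\<^sup>2)" .
  have "(norm (character \<rho> \<one>))\<^sup>2 \<le> (\<Sum>h\<in>N. (norm (character \<rho> h))\<^sup>2)"
    using finN by (intro member_le_sum) auto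
  moreover have "0 < (norm (character \<rho> \<one>))\<^sup>2"
    using n by (simp add: character_eq_trace representation_one [OF \<rho>])
  ultimately have "(\<Sum>h\<in>N. (norm (character \<rho> h))\<^sup>2) \<noteq> 0" by linarith
  then show ?thesis unfolding * of_real_eq_0_iff .
qed

section \<open>Complete reducibility\<close>

text \<open>The columns of \<open>P\<close> are a basis of \<open>W\<close> followed by vectors
  completing it to a basis of the whole space. Its inverse \<open>Q\<close> reads off coordinates,
  and those from \<open>k\<close> on vanish on \<open>W\<close>.\<close>

lemma adapted_basis:
  fixes W :: "complex vec set"
  assumes sub: "VectorSpace.subspace class_ring W (module_vec TYPE(complex) n)"
    and ne: "W \<noteq> {0\<^sub>v n}" "W \<noteq> carrier_vec n"
  obtains k P Q where "0 < k" "k < n" "P \<in> carrier_mat n n" "Q \<in> carrier_mat n n"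
    "P * Q = 1\<^sub>m n" "Q * P = 1\<^sub>m n"
    "\<And>j. j < k \<Longrightarrow> col P j \<in> W"
    "\<And>w i. w \<in> W \<Longrightarrow> k \<le> i \<Longrightarrow> i < n \<Longrightarrow> (Q *\<^sub>v w) $ i = 0"
proof -
  interpret vec_space "TYPE(complex)" n .
  have W: "W \<subseteq> carrier_vec n" "0\<^sub>v n \<in> W"
    using sub by (auto simp: subspace_vec_iff)
  have li: "finite S \<and> card S \<le> n" if "S \<subseteq> carrier_vec n" "lin_indpt S" for S
    using li_le_dim [OF fin_dim, of S] that by (simp add: dim_is_n)
  have empty: "lin_indpt {}" by (rule finite_lin_indpt2) auto
  \<comment> \<open>A basis of \<open>W\<close> is obtained as a maximal independent subset; the
    dimension \<open>n\<close> bounds the size of all candidates.\<close>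
  obtain A where finA: "finite A" and maxA: "maximal A (\<lambda>S. S \<subseteq> W \<and> lin_indpt S)"
    using maximal_exists [of "\<lambda>S. S \<subseteq> W \<and> lin_indpt S" n "{}"] li W empty by blast
  then have A: "A \<subseteq> W" "lin_indpt A" by (auto simp: maximal_def)
  have AV: "A \<subseteq> carrier_vec n" using A W by blast
  have WA: "w \<in> span A" if w: "w \<in> W" for w
  proof (cases "w \<in> A")
    case True
    then show ?thesis using in_own_span [of A] AV by auto
  next
    case False
    have "lin_dep (A \<union> {w})"
    proof (rule ccontr)
      assume "\<not> lin_dep (A \<union> {w})"
      then have "A \<union> {w} = A" using maxA w by (auto simp: maximal_def)
      then show False using False by blast
    qed
    then show ?thesis
      using lin_dep_iff_in_span [of A w] A AV w W False by auto
  qed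
  obtain C where finC: "finite C" and maxC: "maximal C (\<lambda>S. A \<subseteq> S \<and> S \<subseteq> carrier_vec n \<and> lin_indpt S)"
    using maximal_exists [of "\<lambda>S. A \<subseteq> S \<and> S \<subseteq> carrier_vec n \<and> lin_indpt S" n A] li A AV by blast
  then have C: "A \<subseteq> C" "C \<subseteq> carrier_vec n" "lin_indpt C" by (auto simp: maximal_def)
  have "basis C"
    using maxC C by (intro max_li_is_basis) (auto simp: maximal_def)
  then have cardC: "card C = n" and spanC: "span C = carrier_vec n"
    using dim_basis [OF finC] by (auto simp: dim_is_n basis_def)
  obtain xs where xs: "set xs = A" "distinct xs" using finite_distinct_list [OF finA] by blast
  obtain ys where ys: "set ys = C - A" "distinct ys"
    using finite_distinct_list [of "C - A"] finC by blast
  define zs where "zs = xs @ ys"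
  have zs: "set zs = C" "distinct zs"
    using xs ys C(1) by (auto simp: zs_def)
  then have zs: "set zs = C" "distinct zs" "length zs = n"
    using distinct_card [of zs] cardC by auto
  define P where "P = mat_of_cols n zs"
  have P: "P \<in> carrier_mat n n" using mat_of_cols_carrier(1) [of n zs] zs(3) by (simp add: P_def)
  have colsP: "cols P = zs" unfolding P_def using zs(1) C(2) by (intro cols_mat_of_cols) auto
  have "rank P = n"
    by (rule lin_indpt_full_rank [OF P]) (simp_all add: colsP zs C)
  then have "det P \<noteq> 0" using det_rank_iff [OF P] by simp
  then obtain Q where Q: "Q \<in> carrier_mat n n" "P * Q = 1\<^sub>m n" "Q * P = 1\<^sub>m n"
    using det_non_zero_imp_unit [OF P] by (auto simp: Units_def ring_mat_def)
  define k where "k = length xs"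
  have kn: "k \<le> n" using zs(3) by (simp add: k_def zs_def)
  have colP: "col P j = zs ! j" if "j < n" for j
    using that colsP P by (metis cols_nth carrier_matD(2))
  have colA: "col P j \<in> A \<longleftrightarrow> j < k" if "j < n" for j
  proof (cases "j < k")
    case True
    then show ?thesis using that xs(1) nth_mem [of j xs] by (simp add: colP zs_def nth_append k_def)
  next
    case False
    then have "ys ! (j - k) \<in> set ys" using that zs(3) by (intro nth_mem) (auto simp: zs_def k_def)
    then show ?thesis using that ys(1) False by (simp add: colP zs_def nth_append k_def)
  qed
  have "k \<noteq> 0"
  proof
    assume "k = 0"
    then have "A = {}" using xs(1) by (simp add: k_def)
    then have "W \<subseteq> {0\<^sub>v n}" using WA span_empty by auto
    then show False using ne(1) W(2) by blast
  qed
  moreover have "k \<noteq> n"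
  proof
    assume "k = n"
    then have "ys = []" using zs(3) by (simp add: k_def zs_def)
    then have "C = A" using ys(1) C(1) by auto
    moreover have "span A \<subseteq> W"
      using sub A(1) by (intro span_is_subset) (auto simp: VectorSpace.subspace_def)
    ultimately show False using spanC ne(2) W(1) by blast
  qed
  moreover have "(Q *\<^sub>v w) $ i = 0" if w: "w \<in> W" and i: "k \<le> i" "i < n" for w i
  proof -
    obtain a where a: "lincomb a A = w"
      using finite_in_span [OF finA] AV WA [OF w] by auto
    \<comment> \<open>The coefficients of \<open>w\<close> are extended by zero from
      \<open>A\<close> to the full basis \<open>C\<close>, whose vectors are the columns of
      \<open>P\<close>.\<close>
    define b where "b = (\<lambda>v. if v \<in> A then a v else 0)"
    define u where "u = vec n (\<lambda>j. b (col P j))"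
    have wV: "w \<in> carrier_vec n" using w W by blast
    have "P *\<^sub>v u = lincomb b C"
      using mat_mult_eq_lincomb [OF P, of b] zs by (simp add: u_def colsP)
    also have "\<dots> = w"
    proof (rule eq_vecI)
      show "dim_vec (lincomb b C) = dim_vec w"
        using lincomb_dim [OF finC C(2), of b] wV by simp
      fix l assume "l < dim_vec w"
      then have l: "l < n" using wV by simp
      have "lincomb b C $ l = (\<Sum>v\<in>C. b v * v $ l)" by (rule lincomb_index [OF l C(2)])
      also have "\<dots> = (\<Sum>v\<in>A. a v * v $ l)"
        using C(1) finC by (intro sum.mono_neutral_cong_right) (auto simp: b_def)
      also have "\<dots> = w $ l" using lincomb_index [OF l AV, of a] a by simp
      finally show "lincomb b C $ l = w $ l" .
    qed
    finally have "Q *\<^sub>v w = Q *\<^sub>v (P *\<^sub>v u)" by simp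
    also have "\<dots> = u"
      using assoc_mult_mat_vec [OF Q(1) P, of u] Q(3) by (simp add: u_def)
    finally show ?thesis using i colA [OF i(2)] by (simp add: u_def b_def)
  qed
  moreover have "col P j \<in> W" if "j < k" for j
    using that colA [of j] kn A(1) by auto
  ultimately show ?thesis
    using that [of k P Q] P Q kn by simp
qed

lemma four_block_mat_eqD:
  assumes "four_block_mat A B C D = four_block_mat A' B' C' D'"
    and "A \<in> carrier_mat m m" "B \<in> carrier_mat m k" "C \<in> carrier_mat k m" "D \<in> carrier_mat k k"
    and "A' \<in> carrier_mat m m" "B' \<in> carrier_mat m k" "C' \<in> carrier_mat k m" "D' \<in> carrier_mat k k"
  shows "A = A'" "B = B'" "D = D'"
proof -
  have eq: "four_block_mat A B C D $$ (i, j) = four_block_mat A' B' C' D' $$ (i, j)" for i j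
    using assms(1) by simp
  show "A = A'"
  proof (rule eq_matI)
    show "A $$ (i, j) = A' $$ (i, j)" if "i < dim_row A'" "j < dim_col A'" for i j
      using eq [of i j] that assms(2-) by simp
  qed (use assms in auto)
  show "B = B'"
  proof (rule eq_matI)
    show "B $$ (i, j) = B' $$ (i, j)" if "i < dim_row B'" "j < dim_col B'" for i j
      using eq [of i "j + m"] that assms(2-) by simp
  qed (use assms in auto)
  show "D = D'"
  proof (rule eq_matI)
    show "D $$ (i, j) = D' $$ (i, j)" if "i < dim_row D'" "j < dim_col D'" for i j
      using eq [of "i + m" "j + m"] that assms(2-) by simp
  qed (use assms in auto)
qed

lemma mat_sum_add:
  assumes "\<And>s. s \<in> S \<Longrightarrow> f s \<in> carrier_mat m k" "\<And>s. s \<in> S \<Longrightarrow> h s \<in> carrier_mat m k"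
  shows "mat_sum m k (\<lambda>s. f s + h s) S = mat_sum m k f S + mat_sum m k h S"
proof (rule eq_matI)
  fix i j assume "i < dim_row (mat_sum m k f S + mat_sum m k h S)" "j < dim_col (mat_sum m k f S + mat_sum m k h S)"
  then have ij: "i < m" "j < k" by (auto simp: mat_sum_def)
  have "(\<Sum>s\<in>S. (f s + h s) $$ (i, j)) = (\<Sum>s\<in>S. f s $$ (i, j) + h s $$ (i, j))"
    using ij carrier_matD [OF assms(2)] by (intro sum.cong refl) simp
  then show "mat_sum m k (\<lambda>s. f s + h s) S $$ (i, j) = (mat_sum m k f S + mat_sum m k h S) $$ (i, j)"
    using ij by (simp add: mat_sum_def sum.distrib)
qed (auto simp: mat_sum_def)

lemma mat_sum_const:
  assumes "A \<in> carrier_mat m k"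
  shows "mat_sum m k (\<lambda>_. A) S = of_nat (card S) \<cdot>\<^sub>m A"
  using assms by (intro eq_matI) (auto simp: mat_sum_def)

text \<open>The off-diagonal block \<open>B\<close> is a cocycle, hence the coboundary of
  the average \<open>S = 1 / |G| \<Sum>\<^sub>h B h C (h\<^sup>-\<^sup>1)\<close>.\<close>

lemma (in group) block_triangular_coboundary:
  assumes A: "\<And>g. g \<in> carrier G \<Longrightarrow> A g \<in> carrier_mat k k"
    and B: "\<And>g. g \<in> carrier G \<Longrightarrow> B g \<in> carrier_mat k l"
    and C: "representation G l C"
    and cocycle: "\<And>g h. g \<in> carrier G \<Longrightarrow> h \<in> carrier G \<Longrightarrow> B (g \<otimes> h) = A g * B h + B g * C h"
    and fin: "finite (carrier G)"
  obtains S where "S \<in> carrier_mat k l" "\<And>g. g \<in> carrier G \<Longrightarrow> S * C g = A g * S + B g"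
proof -
  note Cc = representation_carrier [OF C]
  define T where "T = mat_sum k l (\<lambda>h. B h * C (inv h)) (carrier G)"
  have T: "T \<in> carrier_mat k l" by (simp add: T_def)
  define c where "c = (of_nat (card (carrier G)) :: complex)"
  have c: "c \<noteq> 0" using fin one_closed by (auto simp: c_def card_eq_0_iff)
  have TC: "T * C g = A g * T + c \<cdot>\<^sub>m B g" if g: "g \<in> carrier G" for g
  proof -
    have BC: "B h * C (inv h) \<in> carrier_mat k l" if "h \<in> carrier G" for h
      by (rule mult_carrier_mat [OF B [OF that] Cc [OF inv_closed [OF that]]])
    have ABC: "A g * (B h * C (inv h)) \<in> carrier_mat k l" if "h \<in> carrier G" for h
      by (rule mult_carrier_mat [OF A [OF g] BC [OF that]])
    have "T * C g = mat_sum k l (\<lambda>h. B h * C (inv h) * C g) (carrier G)"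
      unfolding T_def by (rule mat_sum_mult [OF Cc [OF g] BC])
    \<comment> \<open>Translating the index by \<open>g\<close> brings the cocycle identity into
      play. Its second term loses all dependence on \<open>h\<close>, because \<open>C h\<close>
      meets its inverse, and so is counted once for each group element.\<close>
    also have "\<dots> = mat_sum k l (\<lambda>h. B (g \<otimes> h) * C (inv (g \<otimes> h)) * C g) (carrier G)"
      by (rule mat_sum_reindex [OF bij_betw_mult_left [OF subgroup_self g]])
    also have "\<dots> = mat_sum k l (\<lambda>h. A g * (B h * C (inv h)) + B g) (carrier G)"
    proof (rule mat_sum_cong)
      fix h assume h: "h \<in> carrier G"
      have Ci: "C (inv h) \<in> carrier_mat l l" using Cc h by simp
      have "B (g \<otimes> h) * C (inv (g \<otimes> h)) * C g = B (g \<otimes> h) * (C (inv (g \<otimes> h)) * C g)"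
        using g h by (intro assoc_mult_mat [OF B Cc Cc]) auto
      also have "C (inv (g \<otimes> h)) * C g = C (inv h)"
        using g h representation_mult [OF C, of "inv (g \<otimes> h)" g] by (simp add: inv_mult_group m_assoc)
      also have "B (g \<otimes> h) * C (inv h) = A g * B h * C (inv h) + B g * C h * C (inv h)"
        unfolding cocycle [OF g h]
        using A [OF g] B [OF h] B [OF g] Cc [OF h] by (intro add_mult_distrib_mat [OF _ _ Ci]) auto
      also have "A g * B h * C (inv h) = A g * (B h * C (inv h))"
        by (rule assoc_mult_mat [OF A [OF g] B [OF h] Ci])
      also have "B g * C h * C (inv h) = B g * (C h * C (inv h))"
        by (rule assoc_mult_mat [OF B [OF g] Cc [OF h] Ci])
      also have "\<dots> = B g" using representation_inv [OF C h] B [OF g] by simp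
      finally show "B (g \<otimes> h) * C (inv (g \<otimes> h)) * C g = A g * (B h * C (inv h)) + B g" .
    qed
    also have "\<dots> = mat_sum k l (\<lambda>h. A g * (B h * C (inv h))) (carrier G) + mat_sum k l (\<lambda>h. B g) (carrier G)"
      by (rule mat_sum_add [OF ABC B [OF g]])
    also have "mat_sum k l (\<lambda>h. A g * (B h * C (inv h))) (carrier G) = A g * T"
      unfolding T_def by (rule mult_mat_sum [OF A [OF g] BC, symmetric])
    also have "mat_sum k l (\<lambda>h. B g) (carrier G) = c \<cdot>\<^sub>m B g"
      unfolding c_def by (rule mat_sum_const [OF B [OF g]])
    finally show ?thesis .
  qed
  show ?thesis
  proof (rule that)
    show "(1 / c) \<cdot>\<^sub>m T \<in> carrier_mat k l" using T by simp
    fix g assume g: "g \<in> carrier G"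
    have "(1 / c) \<cdot>\<^sub>m T * C g = (1 / c) \<cdot>\<^sub>m (A g * T + c \<cdot>\<^sub>m B g)"
      unfolding TC [OF g, symmetric] by (rule mult_smult_assoc_mat [OF T Cc [OF g]])
    also have "\<dots> = (1 / c) \<cdot>\<^sub>m (A g * T) + (1 / c) \<cdot>\<^sub>m (c \<cdot>\<^sub>m B g)"
      using A [OF g] B [OF g] T by (intro add_smult_distrib_left_mat) auto
    also have "(1 / c) \<cdot>\<^sub>m (c \<cdot>\<^sub>m B g) = B g"
      using c by (intro eq_matI) auto
    also have "(1 / c) \<cdot>\<^sub>m (A g * T) = A g * ((1 / c) \<cdot>\<^sub>m T)"
      by (rule mult_smult_distrib [OF A [OF g] T, symmetric])
    finally show "(1 / c) \<cdot>\<^sub>m T * C g = A g * ((1 / c) \<cdot>\<^sub>m T) + B g" .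
  qed
qed

lemma rep_iso_trans: "rep_iso G \<rho> \<tau> \<Longrightarrow> rep_iso G \<tau> \<upsilon> \<Longrightarrow> rep_iso G \<rho> \<upsilon>"
  unfolding rep_iso_def using similar_mat_wit_trans by blast

lemma rep_iso_sym: "rep_iso G \<rho> \<tau> \<Longrightarrow> rep_iso G \<tau> \<rho>"
  unfolding rep_iso_def using similar_mat_wit_sym by blast

lemma rep_iso_refl: "(\<And>g. g \<in> carrier G \<Longrightarrow> \<rho> g \<in> carrier_mat n n) \<Longrightarrow> rep_iso G \<rho> \<rho>"
  unfolding rep_iso_def using similar_mat_wit_refl by blast

lemma rep_iso_character: "rep_iso G \<rho> \<tau> \<Longrightarrow> g \<in> carrier G \<Longrightarrow> character \<rho> g = character \<tau> g"
  unfolding rep_iso_def character_eq_trace using mat_trace_similar by blast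

lemma rep_iso_carrier:
  assumes "rep_iso G \<rho> \<tau>" "g \<in> carrier G" "\<rho> g \<in> carrier_mat n n"
  shows "\<tau> g \<in> carrier_mat n n"
  using assms similar_mat_witD2(5) unfolding rep_iso_def by blast

lemma rep_iso_four_block:
  assumes "rep_iso G \<rho> \<rho>'" "rep_iso G \<tau> \<tau>'"
    and "\<And>g. g \<in> carrier G \<Longrightarrow> \<rho> g \<in> carrier_mat m m" "\<And>g. g \<in> carrier G \<Longrightarrow> \<tau> g \<in> carrier_mat k k"
  shows "rep_iso G (\<lambda>g. four_block_mat (\<rho> g) (0\<^sub>m m k) (0\<^sub>m k m) (\<tau> g))
    (\<lambda>g. four_block_mat (\<rho>' g) (0\<^sub>m m k) (0\<^sub>m k m) (\<tau>' g))"
proof -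
  obtain P Q where PQ: "\<And>g. g \<in> carrier G \<Longrightarrow> similar_mat_wit (\<rho> g) (\<rho>' g) P Q"
    using assms(1) by (auto simp: rep_iso_def)
  obtain P' Q' where PQ': "\<And>g. g \<in> carrier G \<Longrightarrow> similar_mat_wit (\<tau> g) (\<tau>' g) P' Q'"
    using assms(2) by (auto simp: rep_iso_def)
  have "similar_mat_wit (four_block_mat (\<rho> g) (0\<^sub>m m k) (0\<^sub>m k m) (\<tau> g))
      (four_block_mat (\<rho>' g) (0\<^sub>m m k) (0\<^sub>m k m) (\<tau>' g))
      (four_block_mat P (0\<^sub>m m k) (0\<^sub>m k m) P') (four_block_mat Q (0\<^sub>m m k) (0\<^sub>m k m) Q')"
    if g: "g \<in> carrier G" for g
  proof (rule similar_mat_wit_four_block [OF PQ [OF g] PQ' [OF g]])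
    note D = similar_mat_witD2 [OF assms(3) [OF g] PQ [OF g]]
    note D' = similar_mat_witD2 [OF assms(4) [OF g] PQ' [OF g]]
    show "0\<^sub>m m k = P * 0\<^sub>m m k * Q'" "0\<^sub>m k m = P' * 0\<^sub>m k m * Q"
      using D(6,7) D'(6,7) by simp_all
  qed (use assms g in auto)
  then show ?thesis unfolding rep_iso_def by blast
qed

text \<open>In a basis adapted to an invariant subspace the matrices are block upper triangular. The
  off-diagonal block is a coboundary, and conjugation by the corresponding unipotent matrix removes
  it.\<close>

lemma (in group) maschke:
  assumes \<tau>: "representation G n \<tau>" and n: "0 < n" and red: "\<not> irreducible_rep G n \<tau>"
    and fin: "finite (carrier G)"
  obtains k l A C where "0 < k" "0 < l" "k + l = n" "representation G k A" "representation G l C"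
    "rep_iso G \<tau> (\<lambda>g. four_block_mat (A g) (0\<^sub>m k l) (0\<^sub>m l k) (C g))"
proof -
  note \<tau>c = representation_carrier [OF \<tau>]
  obtain W where W: "VectorSpace.subspace class_ring W (module_vec TYPE(complex) n)"
    and inv: "\<And>g w. g \<in> carrier G \<Longrightarrow> w \<in> W \<Longrightarrow> \<tau> g *\<^sub>v w \<in> W"
    and ne: "W \<noteq> {0\<^sub>v n}" "W \<noteq> carrier_vec n"
    using red \<tau> n by (auto simp: irreducible_rep_def)
  obtain k P Q where k: "0 < k" "k < n" and P: "P \<in> carrier_mat n n" and Q: "Q \<in> carrier_mat n n"
    and PQ: "P * Q = 1\<^sub>m n" "Q * P = 1\<^sub>m n"
    and colP: "\<And>j. j < k \<Longrightarrow> col P j \<in> W"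
    and Q0: "\<And>w i. w \<in> W \<Longrightarrow> k \<le> i \<Longrightarrow> i < n \<Longrightarrow> (Q *\<^sub>v w) $ i = 0"
    by (rule adapted_basis [OF W ne]) blast
  define l where "l = n - k"
  have kl: "k + l = n" "0 < l" using k by (auto simp: l_def)
  define R where "R = (\<lambda>g. Q * \<tau> g * P)"
  have Rc: "R g \<in> carrier_mat n n" if "g \<in> carrier G" for g
    unfolding R_def by (rule mult_carrier_mat [OF mult_carrier_mat [OF Q \<tau>c [OF that]] P])
  have \<tau>R: "rep_iso G \<tau> R"
  proof (rule rep_iso_sym)
    have "similar_mat_wit (R g) (\<tau> g) Q P" if "g \<in> carrier G" for g
      using P Q PQ Rc [OF that] \<tau>c [OF that] by (intro similar_mat_witI [of _ _ n]) (auto simp: R_def)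
    then show "rep_iso G R \<tau>" unfolding rep_iso_def by blast
  qed
  have Rmult: "R (g \<otimes> h) = R g * R h" if g: "g \<in> carrier G" and h: "h \<in> carrier G" for g h
  proof -
    have Qg: "Q * \<tau> g \<in> carrier_mat n n" and hP: "\<tau> h * P \<in> carrier_mat n n"
      using Q P \<tau>c [OF g] \<tau>c [OF h] by auto
    have "R g * R h = Q * \<tau> g * P * (Q * (\<tau> h * P))"
      unfolding R_def assoc_mult_mat [OF Q \<tau>c [OF h] P] ..
    also have "\<dots> = Q * \<tau> g * (P * (Q * (\<tau> h * P)))"
      using Q hP by (intro assoc_mult_mat [OF Qg P]) auto
    also have "P * (Q * (\<tau> h * P)) = P * Q * (\<tau> h * P)"
      by (rule assoc_mult_mat [OF P Q hP, symmetric])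
    also have "\<dots> = \<tau> h * P" unfolding PQ by (rule left_mult_one_mat [OF hP])
    also have "Q * \<tau> g * (\<tau> h * P) = Q * \<tau> g * \<tau> h * P"
      by (rule assoc_mult_mat [OF Qg \<tau>c [OF h] P, symmetric])
    also have "Q * \<tau> g * \<tau> h = Q * \<tau> (g \<otimes> h)"
      unfolding representation_mult [OF \<tau> g h] by (rule assoc_mult_mat [OF Q \<tau>c [OF g] \<tau>c [OF h]])
    finally show ?thesis by (simp add: R_def)
  qed
  have R1: "R \<one> = 1\<^sub>m n"
    unfolding R_def representation_one [OF \<tau>] using Q by (simp add: PQ)
  define A where "A = (\<lambda>g. mat k k (\<lambda>(i, j). R g $$ (i, j)))"
  define B where "B = (\<lambda>g. mat k l (\<lambda>(i, j). R g $$ (i, j + k)))"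
  define C where "C = (\<lambda>g. mat l l (\<lambda>(i, j). R g $$ (i + k, j + k)))"
  have Ac: "A g \<in> carrier_mat k k" and Bc: "B g \<in> carrier_mat k l" and Cc: "C g \<in> carrier_mat l l" for g
    by (auto simp: A_def B_def C_def)
  \<comment> \<open>The first \<open>k\<close> columns of \<open>P\<close> lie in \<open>W\<close>,
    which the action preserves, so their images have no coordinates beyond \<open>k\<close>.\<close>
  have R0: "R g $$ (i, j) = 0" if g: "g \<in> carrier G" and ij: "k \<le> i" "i < n" "j < k" for g i j
  proof -
    have j: "j < n" using ij k by simp
    have gP: "\<tau> g * P \<in> carrier_mat n n" using \<tau>c [OF g] P by simp
    have "R g $$ (i, j) = (Q * (\<tau> g * P)) $$ (i, j)"
      unfolding R_def assoc_mult_mat [OF Q \<tau>c [OF g] P] ..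
    also have "\<dots> = (Q *\<^sub>v col (\<tau> g * P) j) $ i"
      using Q P gP ij j by simp
    also have "col (\<tau> g * P) j = \<tau> g *\<^sub>v col P j"
      by (rule col_mult2 [OF \<tau>c [OF g] P j])
    also have "(Q *\<^sub>v (\<tau> g *\<^sub>v col P j)) $ i = 0"
      using Q0 [OF inv [OF g colP [OF ij(3)]] ij(1,2)] .
    finally show ?thesis .
  qed
  have RABC: "R g = four_block_mat (A g) (B g) (0\<^sub>m l k) (C g)" if g: "g \<in> carrier G" for g
  proof (rule eq_matI)
    fix i j assume "i < dim_row (four_block_mat (A g) (B g) (0\<^sub>m l k) (C g))"
      "j < dim_col (four_block_mat (A g) (B g) (0\<^sub>m l k) (C g))"
    then have ij: "i < n" "j < n" using Ac [of g] Cc [of g] kl by auto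
    then show "R g $$ (i, j) = four_block_mat (A g) (B g) (0\<^sub>m l k) (C g) $$ (i, j)"
      using kl R0 [OF g, of i j] by (auto simp: A_def B_def C_def)
  qed (use Rc [OF g] kl Ac [of g] Cc [of g] in auto)
  have mult: "A (g \<otimes> h) = A g * A h" "B (g \<otimes> h) = A g * B h + B g * C h" "C (g \<otimes> h) = C g * C h"
    if g: "g \<in> carrier G" and h: "h \<in> carrier G" for g h
  proof -
    have "four_block_mat (A (g \<otimes> h)) (B (g \<otimes> h)) (0\<^sub>m l k) (C (g \<otimes> h)) =
        four_block_mat (A g) (B g) (0\<^sub>m l k) (C g) * four_block_mat (A h) (B h) (0\<^sub>m l k) (C h)"
      using RABC [OF g] RABC [OF h] RABC [of "g \<otimes> h"] Rmult [OF g h] g h by simp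
    also have "\<dots> = four_block_mat (A g * A h + B g * 0\<^sub>m l k) (A g * B h + B g * C h)
        (0\<^sub>m l k * A h + C g * 0\<^sub>m l k) (0\<^sub>m l k * B h + C g * C h)"
      by (rule mult_four_block_mat [OF Ac Bc _ Cc Ac Bc _ Cc]) auto
    also have "\<dots> = four_block_mat (A g * A h) (A g * B h + B g * C h) (0\<^sub>m l k) (C g * C h)"
      using Ac [of g] Bc [of g] Cc [of g] Ac [of h] Bc [of h] Cc [of h] by simp
    finally have eq: "four_block_mat (A (g \<otimes> h)) (B (g \<otimes> h)) (0\<^sub>m l k) (C (g \<otimes> h)) =
      four_block_mat (A g * A h) (A g * B h + B g * C h) (0\<^sub>m l k) (C g * C h)" .
    have c: "A g * A h \<in> carrier_mat k k" "A g * B h + B g * C h \<in> carrier_mat k l"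
      "C g * C h \<in> carrier_mat l l"
      using Ac [of g] Bc [of g] Cc [of g] Ac [of h] Bc [of h] Cc [of h] by auto
    note * = four_block_mat_eqD [OF eq Ac Bc zero_carrier_mat Cc c(1,2) zero_carrier_mat c(3)]
    show "A (g \<otimes> h) = A g * A h" "B (g \<otimes> h) = A g * B h + B g * C h" "C (g \<otimes> h) = C g * C h"
      using * by auto
  qed
  have one: "A \<one> = 1\<^sub>m k" "C \<one> = 1\<^sub>m l"
  proof -
    have eq: "four_block_mat (A \<one>) (B \<one>) (0\<^sub>m l k) (C \<one>) = four_block_mat (1\<^sub>m k) (0\<^sub>m k l) (0\<^sub>m l k) (1\<^sub>m l)"
      using RABC [OF one_closed] R1 kl by simp
    show "A \<one> = 1\<^sub>m k" "C \<one> = 1\<^sub>m l"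
      using four_block_mat_eqD [OF eq Ac Bc zero_carrier_mat Cc one_carrier_mat zero_carrier_mat
        zero_carrier_mat one_carrier_mat] by auto
  qed
  have A: "representation G k A" and C: "representation G l C"
    using Ac Cc mult one by (auto simp: representation_iff [OF group_axioms])
  obtain S where S: "S \<in> carrier_mat k l" and SC: "\<And>g. g \<in> carrier G \<Longrightarrow> S * C g = A g * S + B g"
    by (rule block_triangular_coboundary [of A k B l C]) (use Ac Bc C mult(2) fin in blast)+
  \<comment> \<open>The relation \<open>S * C g = A g * S + B g\<close> says exactly that
    \<open>U\<close> carries the block diagonal matrix to the triangular one; \<open>V\<close> is
    the inverse of \<open>U\<close>.\<close>
  define U where "U = four_block_mat (1\<^sub>m k) S (0\<^sub>m l k) (1\<^sub>m l)"
  define V where "V = four_block_mat (1\<^sub>m k) (- S) (0\<^sub>m l k) (1\<^sub>m l)"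
  have UV: "U \<in> carrier_mat n n" "V \<in> carrier_mat n n"
    using kl by (auto simp: U_def V_def)
  have inv: "U * V = 1\<^sub>m n" "V * U = 1\<^sub>m n"
  proof -
    have "U * V = four_block_mat (1\<^sub>m k * 1\<^sub>m k + S * 0\<^sub>m l k) (1\<^sub>m k * - S + S * 1\<^sub>m l)
        (0\<^sub>m l k * 1\<^sub>m k + 1\<^sub>m l * 0\<^sub>m l k) (0\<^sub>m l k * - S + 1\<^sub>m l * 1\<^sub>m l)"
      unfolding U_def V_def using S by (intro mult_four_block_mat) auto
    also have "\<dots> = four_block_mat (1\<^sub>m k) (0\<^sub>m k l) (0\<^sub>m l k) (1\<^sub>m l)"
      using S by (intro cong_four_block_mat) (auto intro!: eq_matI)
    finally show "U * V = 1\<^sub>m n" using kl by simp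
    have "V * U = four_block_mat (1\<^sub>m k * 1\<^sub>m k + - S * 0\<^sub>m l k) (1\<^sub>m k * S + - S * 1\<^sub>m l)
        (0\<^sub>m l k * 1\<^sub>m k + 1\<^sub>m l * 0\<^sub>m l k) (0\<^sub>m l k * S + 1\<^sub>m l * 1\<^sub>m l)"
      unfolding U_def V_def using S by (intro mult_four_block_mat) auto
    also have "\<dots> = four_block_mat (1\<^sub>m k) (0\<^sub>m k l) (0\<^sub>m l k) (1\<^sub>m l)"
      using S by (intro cong_four_block_mat) (auto intro!: eq_matI)
    finally show "V * U = 1\<^sub>m n" using kl by simp
  qed
  have "similar_mat_wit (R g) (four_block_mat (A g) (0\<^sub>m k l) (0\<^sub>m l k) (C g)) U V"
    if g: "g \<in> carrier G" for g
  proof (rule similar_mat_witI [OF inv])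
    let ?D = "four_block_mat (A g) (0\<^sub>m k l) (0\<^sub>m l k) (C g)"
    note c = Ac [of g] Bc [of g] Cc [of g] S
    have SCc: "S * C g \<in> carrier_mat k l" and AS: "A g * S \<in> carrier_mat k l"
      using c by auto
    have "U * ?D = four_block_mat (1\<^sub>m k * A g + S * 0\<^sub>m l k) (1\<^sub>m k * 0\<^sub>m k l + S * C g)
        (0\<^sub>m l k * A g + 1\<^sub>m l * 0\<^sub>m l k) (0\<^sub>m l k * 0\<^sub>m k l + 1\<^sub>m l * C g)"
      unfolding U_def using c by (intro mult_four_block_mat) auto
    also have "\<dots> = four_block_mat (A g) (S * C g) (0\<^sub>m l k) (C g)"
      using c SCc by (intro cong_four_block_mat) auto
    finally have UD: "U * ?D = four_block_mat (A g) (S * C g) (0\<^sub>m l k) (C g)" .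
    have "U * ?D * V = four_block_mat (A g * 1\<^sub>m k + S * C g * 0\<^sub>m l k) (A g * - S + S * C g * 1\<^sub>m l)
        (0\<^sub>m l k * 1\<^sub>m k + C g * 0\<^sub>m l k) (0\<^sub>m l k * - S + C g * 1\<^sub>m l)"
      unfolding UD unfolding V_def using c SCc by (intro mult_four_block_mat) auto
    also have "\<dots> = four_block_mat (A g) (B g) (0\<^sub>m l k) (C g)"
    proof (intro cong_four_block_mat)
      have "A g * - S + S * C g * 1\<^sub>m l = - (A g * S) + (A g * S + B g)"
        using c SCc SC [OF g] by simp
      also have "\<dots> = B g"
      proof -
        have "- X + (X + Y) = Y" if "X \<in> carrier_mat k l" "Y \<in> carrier_mat k l" for X Y :: "complex mat"
          using that by (intro eq_matI) auto
        then show ?thesis using AS Bc by blast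
      qed
      finally show "A g * - S + S * C g * 1\<^sub>m l = B g" .
    qed (use c SCc in auto)
    finally show "R g = U * ?D * V" using RABC [OF g] by simp
    show "?D \<in> carrier_mat n n" using c kl by auto
  qed (use UV Rc g in auto)
  then have "rep_iso G R (\<lambda>g. four_block_mat (A g) (0\<^sub>m k l) (0\<^sub>m l k) (C g))"
    unfolding rep_iso_def by blast
  then have "rep_iso G \<tau> (\<lambda>g. four_block_mat (A g) (0\<^sub>m k l) (0\<^sub>m l k) (C g))"
    by (rule rep_iso_trans [OF \<tau>R])
  then show ?thesis using that k kl A C by blast
qed

section \<open>Direct sums indexed by lists, and their reordering\<close>

definition rep_sum :: "('g \<Rightarrow> complex mat) list \<Rightarrow> 'g \<Rightarrow> complex mat" where
  "rep_sum \<tau>s g = diag_block_mat (map (\<lambda>\<tau>. \<tau> g) \<tau>s)"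

text \<open>Block manipulations depend only on a size that is constant over the group, so this is
  the invariant carried through the list inductions.\<close>

definition square_family :: "('g, 'b) monoid_scheme \<Rightarrow> ('g \<Rightarrow> complex mat) \<Rightarrow> bool" where
  "square_family G \<tau> \<longleftrightarrow> (\<exists>n. \<forall>g\<in>carrier G. \<tau> g \<in> carrier_mat n n)"

lemma square_familyE:
  assumes "square_family G \<tau>"
  obtains n where "\<And>g. g \<in> carrier G \<Longrightarrow> \<tau> g \<in> carrier_mat n n"
  using assms by (auto simp: square_family_def)

lemma rep_sum_append:
  assumes "rep_sum \<tau>s g \<in> carrier_mat m m" "rep_sum \<upsilon>s g \<in> carrier_mat k k"
  shows "rep_sum (\<tau>s @ \<upsilon>s) g = four_block_mat (rep_sum \<tau>s g) (0\<^sub>m m k) (0\<^sub>m k m) (rep_sum \<upsilon>s g)"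
  using assms unfolding rep_sum_def by (simp add: diag_block_mat_append Let_def)

lemma rep_sum_singleton [simp]: "rep_sum [\<tau>] g = \<tau> g"
  by (simp only: rep_sum_def list.map diag_block_mat_singleton)

lemma square_family_rep_sum:
  assumes "\<forall>\<tau>\<in>set \<tau>s. square_family G \<tau>"
  shows "square_family G (rep_sum \<tau>s)"
  using assms
proof (induction \<tau>s)
  case Nil
  then show ?case by (auto simp: square_family_def rep_sum_def intro!: exI [of _ 0])
next
  case (Cons \<tau> \<tau>s)
  obtain m where m: "\<And>g. g \<in> carrier G \<Longrightarrow> \<tau> g \<in> carrier_mat m m"
    using square_familyE [of G \<tau>] Cons.prems by auto
  obtain k where k: "\<And>g. g \<in> carrier G \<Longrightarrow> rep_sum \<tau>s g \<in> carrier_mat k k"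
    using square_familyE [OF Cons.IH] Cons.prems by auto
  have "rep_sum (\<tau> # \<tau>s) g \<in> carrier_mat (m + k) (m + k)" if "g \<in> carrier G" for g
    using rep_sum_append [of "[\<tau>]" g m \<tau>s k] m [OF that] k [OF that] by simp
  then show ?case by (auto simp: square_family_def)
qed

lemma rep_iso_append:
  assumes "rep_iso G (rep_sum as) (rep_sum as')" "rep_iso G (rep_sum bs) (rep_sum bs')"
    and "\<forall>\<tau>\<in>set as. square_family G \<tau>" "\<forall>\<tau>\<in>set bs. square_family G \<tau>"
  shows "rep_iso G (rep_sum (as @ bs)) (rep_sum (as' @ bs'))"
proof -
  obtain m where m: "\<And>g. g \<in> carrier G \<Longrightarrow> rep_sum as g \<in> carrier_mat m m"
    by (rule square_familyE [OF square_family_rep_sum [OF assms(3)]]) blast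
  obtain k where k: "\<And>g. g \<in> carrier G \<Longrightarrow> rep_sum bs g \<in> carrier_mat k k"
    by (rule square_familyE [OF square_family_rep_sum [OF assms(4)]]) blast
  have eq: "rep_sum (as @ bs) g = four_block_mat (rep_sum as g) (0\<^sub>m m k) (0\<^sub>m k m) (rep_sum bs g)"
    if "g \<in> carrier G" for g
    by (rule rep_sum_append [OF m [OF that] k [OF that]])
  have eq': "rep_sum (as' @ bs') g = four_block_mat (rep_sum as' g) (0\<^sub>m m k) (0\<^sub>m k m) (rep_sum bs' g)"
    if "g \<in> carrier G" for g
    by (rule rep_sum_append [OF rep_iso_carrier [OF assms(1) that m [OF that]]
      rep_iso_carrier [OF assms(2) that k [OF that]]])
  show ?thesis
    using rep_iso_four_block [OF assms(1,2) m k] by (simp add: rep_iso_def eq eq')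
qed

text \<open>The block permutation matrix exchanging the two summands is the same for every group
  element, so it is an isomorphism of the families.\<close>

lemma rep_iso_swap:
  assumes "\<forall>\<tau>\<in>set as. square_family G \<tau>" "\<forall>\<tau>\<in>set bs. square_family G \<tau>"
  shows "rep_iso G (rep_sum (as @ bs)) (rep_sum (bs @ as))"
proof -
  obtain m where m: "\<And>g. g \<in> carrier G \<Longrightarrow> rep_sum as g \<in> carrier_mat m m"
    by (rule square_familyE [OF square_family_rep_sum [OF assms(1)]]) blast
  obtain k where k: "\<And>g. g \<in> carrier G \<Longrightarrow> rep_sum bs g \<in> carrier_mat k k"
    by (rule square_familyE [OF square_family_rep_sum [OF assms(2)]]) blast
  define P where "P = four_block_mat (0\<^sub>m m k) (1\<^sub>m m) (1\<^sub>m k) (0\<^sub>m k m :: complex mat)"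
  define Q where "Q = four_block_mat (0\<^sub>m k m) (1\<^sub>m k) (1\<^sub>m m) (0\<^sub>m m k :: complex mat)"
  have PQ: "P \<in> carrier_mat (m + k) (m + k)" "Q \<in> carrier_mat (m + k) (m + k)"
    by (auto simp: P_def Q_def)
  have inv: "P * Q = 1\<^sub>m (m + k)" "Q * P = 1\<^sub>m (m + k)"
  proof -
    have "P * Q = four_block_mat (0\<^sub>m m k * 0\<^sub>m k m + 1\<^sub>m m * 1\<^sub>m m) (0\<^sub>m m k * 1\<^sub>m k + 1\<^sub>m m * 0\<^sub>m m k)
        (1\<^sub>m k * 0\<^sub>m k m + 0\<^sub>m k m * 1\<^sub>m m) (1\<^sub>m k * 1\<^sub>m k + 0\<^sub>m k m * 0\<^sub>m m k)"
      unfolding P_def Q_def by (rule mult_four_block_mat) auto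
    then show "P * Q = 1\<^sub>m (m + k)" by simp
    have "Q * P = four_block_mat (0\<^sub>m k m * 0\<^sub>m m k + 1\<^sub>m k * 1\<^sub>m k) (0\<^sub>m k m * 1\<^sub>m m + 1\<^sub>m k * 0\<^sub>m k m)
        (1\<^sub>m m * 0\<^sub>m m k + 0\<^sub>m m k * 1\<^sub>m k) (1\<^sub>m m * 1\<^sub>m m + 0\<^sub>m m k * 0\<^sub>m k m)"
      unfolding P_def Q_def by (rule mult_four_block_mat) auto
    then show "Q * P = 1\<^sub>m (m + k)" by (simp add: add.commute)
  qed
  have "similar_mat_wit (rep_sum (as @ bs) g) (rep_sum (bs @ as) g) P Q" if g: "g \<in> carrier G" for g
  proof (rule similar_mat_witI [OF inv])
    let ?X = "rep_sum as g" and ?Y = "rep_sum bs g"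
    note c = m [OF g] k [OF g]
    have X: "rep_sum (as @ bs) g = four_block_mat ?X (0\<^sub>m m k) (0\<^sub>m k m) ?Y"
      and Y: "rep_sum (bs @ as) g = four_block_mat ?Y (0\<^sub>m k m) (0\<^sub>m m k) ?X"
      using c by (simp_all add: rep_sum_append)
    have "P * rep_sum (bs @ as) g = four_block_mat (0\<^sub>m m k * ?Y + 1\<^sub>m m * 0\<^sub>m m k) (0\<^sub>m m k * 0\<^sub>m k m + 1\<^sub>m m * ?X)
        (1\<^sub>m k * ?Y + 0\<^sub>m k m * 0\<^sub>m m k) (1\<^sub>m k * 0\<^sub>m k m + 0\<^sub>m k m * ?X)"
      unfolding P_def Y using c by (intro mult_four_block_mat) auto
    also have "\<dots> = four_block_mat (0\<^sub>m m k) ?X ?Y (0\<^sub>m k m)"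
      using c by (intro cong_four_block_mat) auto
    finally have PY: "P * rep_sum (bs @ as) g = four_block_mat (0\<^sub>m m k) ?X ?Y (0\<^sub>m k m)" .
    have "P * rep_sum (bs @ as) g * Q = four_block_mat (0\<^sub>m m k * 0\<^sub>m k m + ?X * 1\<^sub>m m) (0\<^sub>m m k * 1\<^sub>m k + ?X * 0\<^sub>m m k)
        (?Y * 0\<^sub>m k m + 0\<^sub>m k m * 1\<^sub>m m) (?Y * 1\<^sub>m k + 0\<^sub>m k m * 0\<^sub>m m k)"
      unfolding PY unfolding Q_def using c by (intro mult_four_block_mat) auto
    also have "\<dots> = rep_sum (as @ bs) g"
      unfolding X using c by (intro cong_four_block_mat) auto
    finally show "rep_sum (as @ bs) g = P * rep_sum (bs @ as) g * Q" by simp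
    show "rep_sum (as @ bs) g \<in> carrier_mat (m + k) (m + k)" unfolding X using c by auto
    show "rep_sum (bs @ as) g \<in> carrier_mat (m + k) (m + k)" unfolding Y add.commute [of m k] using c by auto
  qed (use PQ in auto)
  then show ?thesis unfolding rep_iso_def by blast
qed

lemma rep_iso_rep_sum_refl:
  "\<forall>\<tau>\<in>set \<tau>s. square_family G \<tau> \<Longrightarrow> rep_iso G (rep_sum \<tau>s) (rep_sum \<tau>s)"
  by (rule square_familyE [OF square_family_rep_sum], assumption) (rule rep_iso_refl)

text \<open>The head of the first list is located in the second and moved past the summands before
  it by a swap; the induction hypothesis treats the rest.\<close>

lemma rep_iso_permute:
  assumes "mset as = mset bs" "\<forall>\<tau>\<in>set as. square_family G \<tau>"
  shows "rep_iso G (rep_sum as) (rep_sum bs)"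
  using assms
proof (induction as arbitrary: bs)
  case Nil
  then show ?case using rep_iso_rep_sum_refl [of "[]" G] by simp
next
  case (Cons a as)
  have "a \<in> set bs" using Cons.prems(1) by (metis list.set_intros(1) mset_eq_setD)
  then obtain us vs where bs: "bs = us @ a # vs" by (auto simp: in_set_conv_decomp)
  have ms: "mset as = mset (us @ vs)" using Cons.prems(1) by (simp add: bs)
  have sq: "\<forall>\<tau>\<in>set (us @ vs). square_family G \<tau>" "\<forall>\<tau>\<in>set as. square_family G \<tau>" "square_family G a"
    using Cons.prems(2) mset_eq_setD [OF ms] by auto
  have "rep_iso G (rep_sum ([a] @ as)) (rep_sum ([a] @ (us @ vs)))"
    by (rule rep_iso_append [OF rep_iso_rep_sum_refl Cons.IH [OF ms sq(2)]]) (use sq in auto)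
  moreover have "rep_iso G (rep_sum (([a] @ us) @ vs)) (rep_sum ((us @ [a]) @ vs))"
    by (rule rep_iso_append [OF rep_iso_swap rep_iso_rep_sum_refl]) (use sq in auto)
  ultimately have "rep_iso G (rep_sum ([a] @ as)) (rep_sum ((us @ [a]) @ vs))"
    unfolding append_assoc by (rule rep_iso_trans)
  then show ?case by (simp add: bs)
qed

lemma multiplicity_sum_eq:
  "multiplicity_sum r \<sigma> m = rep_sum (map \<sigma> (concat (map (\<lambda>j. replicate (m j) j) [0..<r])))"
  by (auto simp: multiplicity_sum_def rep_sum_def map_concat comp_def)

text \<open>A decomposition arrives as an unordered list of constituents. Counting occurrences gives
  the multiplicities of the sorted form used by \<open>multiplicity_sum\<close>.\<close>

lemma mset_concat_replicate_count:
  assumes "set js \<subseteq> {..<r}"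
  shows "mset (concat (map (\<lambda>j. replicate (count_list js j) j) [0..<r])) = mset js"
proof (rule multiset_eqI)
  fix x :: nat
  have "count (mset (concat (map (\<lambda>j. replicate (m j) j) [0..<r]))) x = (if x < r then m x else 0)"
    for m :: "nat \<Rightarrow> nat"
    by (induction r) auto
  then show "count (mset (concat (map (\<lambda>j. replicate (count_list js j) j) [0..<r]))) x = count (mset js) x"
    using assms by (auto simp: count_mset count_list_0_iff)
qed

lemma mat_trace_diag_block:
  assumes "\<forall>A\<in>set As. square_mat A"
  shows "mat_trace (diag_block_mat As) = (\<Sum>A\<leftarrow>As. mat_trace A)"
  using assms
proof (induction As)
  case (Cons A As)
  have m: "A \<in> carrier_mat (dim_row A) (dim_row A)"
    using Cons.prems by (intro carrier_matI) simp_all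
  have "square_mat (diag_block_mat As)"
    using Cons.prems by (intro diag_block_mat_square) simp
  then have k: "diag_block_mat As \<in> carrier_mat (dim_row (diag_block_mat As)) (dim_row (diag_block_mat As))"
    by (intro carrier_matI) simp_all
  have "mat_trace (diag_block_mat (A # As)) = mat_trace A + mat_trace (diag_block_mat As)"
    unfolding diag_block_mat.simps Let_def by (rule mat_trace_four_block [OF m k])
  also have "mat_trace (diag_block_mat As) = (\<Sum>A\<leftarrow>As. mat_trace A)"
    using Cons.prems by (intro Cons.IH) simp
  finally show ?case by simp
qed (simp add: mat_trace_def)

lemma character_multiplicity_sum:
  assumes "\<forall>j<r. square_mat (\<sigma> j g)"
  shows "character (multiplicity_sum r \<sigma> m) g = (\<Sum>j<r. of_nat (m j) * character (\<sigma> j) g)"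
proof -
  have "character (multiplicity_sum r \<sigma> m) g =
      (\<Sum>A\<leftarrow>concat (map (\<lambda>j. replicate (m j) (\<sigma> j g)) [0..<r]). mat_trace A)"
    unfolding character_eq_trace multiplicity_sum_def
    using assms by (intro mat_trace_diag_block) auto
  also have "\<dots> = (\<Sum>j<r. of_nat (m j) * character (\<sigma> j) g)"
    by (induction r) (auto simp: character_eq_trace sum_list_replicate)
  finally show ?thesis .
qed

text \<open>Induction on the degree: a reducible representation splits into two of smaller positive
  degree, and the lists of constituents are concatenated. The list is sorted only at the
  end.\<close>

lemma (in group) complete_reducibility:
  assumes \<sigma>: "complete_irreps G r d \<sigma>" and fin: "finite (carrier G)" and \<tau>: "representation G n \<tau>"
  obtains m where "rep_iso G \<tau> (multiplicity_sum r \<sigma> m)"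
proof -
  have sq: "square_family G (\<sigma> j)" if "j < r" for j
    using \<sigma> that representation_carrier irreducible_repD(1)
    unfolding complete_irreps_def square_family_def by blast
  have "\<exists>js. set js \<subseteq> {..<r} \<and> rep_iso G \<tau> (rep_sum (map \<sigma> js))"
    using \<tau>
  proof (induction n arbitrary: \<tau> rule: less_induct)
    case (less n)
    note \<tau>c = representation_carrier [OF less.prems]
    consider "n = 0" | "irreducible_rep G n \<tau>" | "0 < n" "\<not> irreducible_rep G n \<tau>" by blast
    then show ?case
    proof cases
      \<comment> \<open>Irreducibility demands positive degree, so degree zero is a base case of its
        own, given by the empty sum.\<close>
      case 1
      have "\<tau> g = rep_sum (map \<sigma> []) g" if "g \<in> carrier G" for g
        using \<tau>c [OF that] 1 by (intro eq_matI) (auto simp: rep_sum_def)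
      then have "rep_iso G \<tau> (rep_sum (map \<sigma> []))"
        using rep_iso_refl [of G \<tau> n] \<tau>c by (simp add: rep_iso_def)
      then show ?thesis by (intro exI [of _ "[]"]) simp
    next
      case 2
      then obtain i where "i < r" "rep_iso G \<tau> (\<sigma> i)"
        using \<sigma> unfolding complete_irreps_def by blast
      then show ?thesis by (intro exI [of _ "[i]"]) (simp add: rep_iso_def)
    next
      case 3
      obtain k l A C where kl: "0 < k" "0 < l" "k + l = n" and A: "representation G k A"
        and C: "representation G l C"
        and iso: "rep_iso G \<tau> (\<lambda>g. four_block_mat (A g) (0\<^sub>m k l) (0\<^sub>m l k) (C g))"
        by (rule maschke [OF less.prems 3 fin])
      obtain js where js: "set js \<subseteq> {..<r}" "rep_iso G A (rep_sum (map \<sigma> js))"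
        using less.IH [OF _ A] kl by auto
      obtain js' where js': "set js' \<subseteq> {..<r}" "rep_iso G C (rep_sum (map \<sigma> js'))"
        using less.IH [OF _ C] kl by auto
      note Ac = representation_carrier [OF A] and Cc = representation_carrier [OF C]
      have "rep_iso G (\<lambda>g. four_block_mat (A g) (0\<^sub>m k l) (0\<^sub>m l k) (C g))
          (\<lambda>g. four_block_mat (rep_sum (map \<sigma> js) g) (0\<^sub>m k l) (0\<^sub>m l k) (rep_sum (map \<sigma> js') g))"
        by (rule rep_iso_four_block [OF js(2) js'(2) Ac Cc])
      moreover have "four_block_mat (rep_sum (map \<sigma> js) g) (0\<^sub>m k l) (0\<^sub>m l k) (rep_sum (map \<sigma> js') g) =
          rep_sum (map \<sigma> (js @ js')) g" if g: "g \<in> carrier G" for g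
        using rep_sum_append [OF rep_iso_carrier [OF js(2) g Ac [OF g]] rep_iso_carrier [OF js'(2) g Cc [OF g]]]
        by simp
      ultimately have "rep_iso G (\<lambda>g. four_block_mat (A g) (0\<^sub>m k l) (0\<^sub>m l k) (C g))
          (rep_sum (map \<sigma> (js @ js')))"
        by (simp add: rep_iso_def)
      with iso have "rep_iso G \<tau> (rep_sum (map \<sigma> (js @ js')))" by (rule rep_iso_trans)
      then show ?thesis using js js' by (intro exI [of _ "js @ js'"]) auto
    qed
  qed
  then obtain js where js: "set js \<subseteq> {..<r}" "rep_iso G \<tau> (rep_sum (map \<sigma> js))" by blast
  have "rep_iso G (rep_sum (map \<sigma> js)) (multiplicity_sum r \<sigma> (count_list js))"
    unfolding multiplicity_sum_eq
  proof (rule rep_iso_permute)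
    show "mset (map \<sigma> js) = mset (map \<sigma> (concat (map (\<lambda>j. replicate (count_list js j) j) [0..<r])))"
      using mset_concat_replicate_count [OF js(1)] by (metis mset_map)
    show "\<forall>\<tau>\<in>set (map \<sigma> js). square_family G \<tau>" using js(1) sq by auto
  qed
  then show ?thesis using that rep_iso_trans [OF js(2)] by blast
qed

section \<open>Components of digraphs\<close>

lemma symcl_rtrancl_on_sym:
  assumes "(u, v) \<in> rtrancl_on F (E\<^sup>s)"
  shows "(v, u) \<in> rtrancl_on F (E\<^sup>s)"
proof -
  have "sym (E\<^sup>s)" by (auto simp: symcl_def sym_def image_iff)
  from rtrancl_on_sym [OF this] assms show ?thesis by (rule symD)
qed

context wf_digraph
begin

text \<open>The class of mutual reachability induces a maximal strongly connected subgraph.\<close>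

lemma same_strong_componentI:
  assumes "u \<rightarrow>\<^sup>* v" "v \<rightarrow>\<^sup>* u"
  shows "same_strong_component G u v"
proof -
  have u: "u \<in> verts G" using assms(1) by (rule reachable_in_verts)
  have "max_subgraph strongly_connected (G \<restriction> scc_of u)"
    using in_verts_sccsD_sccs [OF scc_of_in_sccs_verts [OF u]] sccs_altdef2 by blast
  moreover have "u \<in> scc_of u" "v \<in> scc_of u" using u assms by (auto simp: scc_of_def)
  ultimately show ?thesis unfolding same_strong_component_def by (metis induce_subgraph_verts)
qed

lemma same_strong_component_imp_reachable:
  assumes "same_strong_component G u v"
  shows "u \<rightarrow>\<^sup>* v"
proof -
  obtain H where H: "max_subgraph strongly_connected H" "u \<in> verts H" "v \<in> verts H"
    using assms by (auto simp: same_strong_component_def)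
  then have "u \<rightarrow>\<^sup>*\<^bsub>H\<^esub> v" "subgraph H G"
    by (auto simp: max_subgraph_def strongly_connected_def)
  then show ?thesis by (rule reachable_mono)
qed

text \<open>The component is built by hand as the subgraph \<open>H\<close> induced on all vertices
  that an undirected path joins to \<open>u\<close>; a directed path is in particular an undirected
  one.\<close>

lemma same_weak_componentI:
  assumes uv: "u \<rightarrow>\<^sup>* v"
  shows "same_weak_component G u v"
proof -
  define C where "C = {w. (u, w) \<in> rtrancl_on (verts G) ((arcs_ends G)\<^sup>s)}"
  define H where "H = G \<restriction> C"
  have u: "u \<in> verts G" using uv by (rule reachable_in_verts)
  have C: "C \<subseteq> verts G" by (auto simp: C_def dest: in_rtrancl_on_in_F)
  have uC: "u \<in> C" using u by (auto simp: C_def)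
  have ends: "arcs_ends H = {(a, b) \<in> arcs_ends G. a \<in> C \<and> b \<in> C}"
    by (auto simp: H_def induce_subgraph_def arcs_ends_def arc_to_ends_def)
  have vH: "verts H = C" by (simp add: H_def)
  \<comment> \<open>Every vertex on an undirected path from \<open>u\<close> is again in
    \<open>C\<close>, so the path survives in the induced subgraph.\<close>
  have from_u: "(u, w) \<in> rtrancl_on C ((arcs_ends H)\<^sup>s)" if "w \<in> C" for w
  proof -
    have "(u, w) \<in> rtrancl_on (verts G) ((arcs_ends G)\<^sup>s)" using that by (simp add: C_def)
    then show ?thesis
    proof (induction rule: rtrancl_on_induct)
      case base
      then show ?case using uC by auto
    next
      case (step y z)
      have "y \<in> C" "z \<in> C" using step.hyps by (auto simp: C_def intro: rtrancl_on_into_rtrancl_on)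
      moreover have "(y, z) \<in> (arcs_ends H)\<^sup>s"
        using step.hyps(2) \<open>y \<in> C\<close> \<open>z \<in> C\<close> by (auto simp: symcl_def ends)
      ultimately show ?case using step.IH by (auto intro: rtrancl_on_into_rtrancl_on)
    qed
  qed
  have conn: "connected H"
    unfolding connected_conv vH using uC from_u symcl_rtrancl_on_sym rtrancl_on_trans by (metis empty_iff)
  have sub: "subgraph H G"
    unfolding H_def using C by (intro induced_imp_subgraph induced_induce)
  have "max_subgraph connected H"
    unfolding max_subgraph_def
  proof (intro conjI sub conn allI impI notI, elim conjE)
    \<comment> \<open>A connected subgraph containing \<open>H\<close> contains \<open>u\<close>, so
      its vertices already lie in \<open>C\<close>; an induced subgraph then leaves no room for
      further arcs.\<close>
    fix K assume K: "K \<noteq> H" "subgraph H K" "subgraph K G" "connected K"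
    have uK: "u \<in> verts K" using K(2) uC vH by auto
    have "verts K \<subseteq> C"
    proof
      fix w assume "w \<in> verts K"
      then have "(u, w) \<in> rtrancl_on (verts K) ((arcs_ends K)\<^sup>s)"
        using K(4) uK by (auto simp: connected_conv)
      moreover have "(arcs_ends K)\<^sup>s \<subseteq> (arcs_ends G)\<^sup>s"
        using arcs_ends_mono [OF K(3)] by (auto simp: symcl_def)
      ultimately show "w \<in> C"
        using rtrancl_on_mono [of "(arcs_ends K)\<^sup>s" "(arcs_ends G)\<^sup>s" "verts K" "verts G"] K(3)
        by (auto simp: C_def)
    qed
    then have verts: "verts K = verts H" using K(2) vH by auto
    interpret K: wf_digraph K using K(3) by auto
    have ends_K: "tail K = tail G" "head K = head G"
      using K(3) by (auto simp: subgraph_def compatible_def)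
    have "arcs K \<subseteq> arcs H"
    proof
      fix e assume e: "e \<in> arcs K"
      then have "tail G e \<in> C" "head G e \<in> C"
        using K.tail_in_verts [OF e] K.head_in_verts [OF e] verts vH ends_K by auto
      then show "e \<in> arcs H" using e K(3) by (auto simp: H_def induce_subgraph_def subgraph_def)
    qed
    then have "arcs K = arcs H" using K(2) by auto
    then have "K = H" using verts ends_K by (simp add: H_def induce_subgraph_def)
    then show False using K(1) by simp
  qed
  moreover have "v \<in> C"
    using uv rtrancl_on_mono [of "arcs_ends G" "(arcs_ends G)\<^sup>s" "verts G" "verts G"]
    by (auto simp: C_def reachable_def symcl_def)
  ultimately show ?thesis
    unfolding same_weak_component_def using uC vH by blast
qed

text \<open>An equivalence relation that contains all arcs propagates along undirected paths. It
  will be applied to the relation of being multiples on the kernel.\<close>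

lemma same_weak_component_induct:
  assumes "same_weak_component G u v"
    and refl: "\<And>x. P x x" and sym: "\<And>x y. P x y \<Longrightarrow> P y x"
    and trans: "\<And>x y z. P x y \<Longrightarrow> P y z \<Longrightarrow> P x z"
    and arc: "\<And>x y. (x, y) \<in> arcs_ends G \<Longrightarrow> P x y"
  shows "P u v"
proof -
  obtain H where H: "subgraph H G" "connected H" "u \<in> verts H" "v \<in> verts H"
    using assms(1) by (auto simp: same_weak_component_def max_subgraph_def)
  then have "(u, v) \<in> rtrancl_on (verts H) ((arcs_ends H)\<^sup>s)" by (auto simp: connected_conv)
  then show ?thesis
  proof (induction rule: rtrancl_on_induct)
    case base
    show ?case by (rule refl)
  next
    case (step y z)
    have "P y z" using step.hyps(2) arcs_ends_mono [OF H(1)] by (auto simp: symcl_def intro: arc sym)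
    then show ?case using step.IH trans by blast
  qed
qed

end

section \<open>The McKay quiver\<close>

lemma (in group) tensor_representation:
  assumes \<rho>: "representation G n \<rho>" and \<tau>: "representation G m \<tau>"
  shows "representation G (n * m) (tensor_rep \<rho> \<tau>)"
  unfolding representation_iff [OF group_axioms] tensor_rep_def
  using representation_carrier [OF \<rho>] representation_carrier [OF \<tau>]
  by (auto simp: kronecker_carrier representation_mult [OF \<rho>] representation_mult [OF \<tau>]
      representation_one [OF \<rho>] representation_one [OF \<tau>] kronecker_one mult_kronecker [of _ n _ _ m])

lemma (in group) character_tensor:
  assumes "representation G n \<rho>" "representation G m \<tau>" "g \<in> carrier G"
  shows "character (tensor_rep \<rho> \<tau>) g = character \<rho> g * character \<tau> g"
  unfolding character_eq_trace tensor_rep_def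
  by (rule mat_trace_kronecker [OF representation_carrier [OF assms(1,3)] representation_carrier [OF assms(2,3)]])

locale mckay = group G for G (structure) +
  fixes r n :: nat and d :: "nat \<Rightarrow> nat" and \<sigma> :: "nat \<Rightarrow> 'a \<Rightarrow> complex mat" and \<rho> :: "'a \<Rightarrow> complex mat"
  assumes finite_carrier: "finite (carrier G)"
    and irreps: "complete_irreps G r d \<sigma>"
    and rep: "representation G n \<rho>"
begin

abbreviation "\<chi> i \<equiv> character (\<sigma> i)"
abbreviation "N \<equiv> kernel G (GL n) \<rho>"
abbreviation "edges i j \<equiv> mckay_matrix G r \<sigma> \<rho> $$ (i, j)"
abbreviation "\<Gamma> \<equiv> mckay_quiver G r \<sigma> \<rho>"

lemma irrep: "i < r \<Longrightarrow> irreducible_rep G (d i) (\<sigma> i)"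
  using irreps by (simp add: complete_irreps_def)

lemma irrep_rep: "i < r \<Longrightarrow> representation G (d i) (\<sigma> i)"
  and degree_pos: "i < r \<Longrightarrow> 0 < d i"
  using irrep irreducible_repD by blast+

lemma character_one: "i < r \<Longrightarrow> \<chi> i \<one> = of_nat (d i)"
  using representation_one [OF irrep_rep] by (simp add: character_eq_trace)

lemma card_nonzero: "of_nat (card (carrier G)) \<noteq> (0 :: complex)"
  using finite_carrier one_closed by (auto simp: card_eq_0_iff)

lemma character_orthonormal:
  assumes "i < r" "j < r"
  shows "char_form (carrier G) (\<chi> i) (\<chi> j) = (if i = j then of_nat (card (carrier G)) else 0)"
proof (cases "i = j")
  case True
  then show ?thesis using character_norm [OF irrep] assms by simp
next
  case False
  then have "\<not> rep_iso G (\<sigma> i) (\<sigma> j)" using irreps assms by (simp add: complete_irreps_def)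
  then show ?thesis using character_orthogonal [OF irrep irrep] assms False by simp
qed

lemma char_form_sum_left:
  assumes "S \<subseteq> carrier G" "\<And>g. g \<in> S \<Longrightarrow> f g = (\<Sum>k\<in>K. c k * \<chi> k g)"
  shows "char_form S f \<psi> = (\<Sum>k\<in>K. c k * char_form S (\<chi> k) \<psi>)"
proof -
  have "char_form S f \<psi> = (\<Sum>h\<in>S. \<Sum>k\<in>K. c k * (\<chi> k h * \<psi> (inv h)))"
    unfolding char_form_def using assms(2) by (intro sum.cong refl) (simp add: sum_distrib_right mult.assoc)
  also have "\<dots> = (\<Sum>k\<in>K. \<Sum>h\<in>S. c k * (\<chi> k h * \<psi> (inv h)))" by (rule sum.swap)
  finally show ?thesis by (simp add: char_form_def sum_distrib_left)
qed

text \<open>Orthogonality extracts coefficients. The case of an index outside \<open>K\<close> is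
  what will detect unreachable vertices.\<close>

lemma char_form_combination:
  assumes f: "\<And>g. g \<in> carrier G \<Longrightarrow> f g = (\<Sum>k\<in>K. c k * \<chi> k g)" and K: "K \<subseteq> {..<r}" and j: "j < r"
  shows "char_form (carrier G) f (\<chi> j) = (if j \<in> K then c j * of_nat (card (carrier G)) else 0)"
proof -
  have fin: "finite K" using K finite_subset by blast
  have "char_form (carrier G) f (\<chi> j) = (\<Sum>k\<in>K. c k * char_form (carrier G) (\<chi> k) (\<chi> j))"
    by (rule char_form_sum_left [OF order_refl f])
  also have "\<dots> = (\<Sum>k\<in>K. if k = j then c j * of_nat (card (carrier G)) else 0)"
    using K j by (intro sum.cong refl) (auto simp: character_orthonormal)
  finally show ?thesis using fin by simp
qed

lemma decomposition_character:
  assumes "i < r" "rep_iso G (tensor_rep \<rho> (\<sigma> i)) (multiplicity_sum r \<sigma> m)" "g \<in> carrier G"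
  shows "character \<rho> g * \<chi> i g = (\<Sum>j<r. of_nat (m j) * \<chi> j g)"
proof -
  have "character \<rho> g * \<chi> i g = character (multiplicity_sum r \<sigma> m) g"
    using rep_iso_character [OF assms(2,3)] character_tensor [OF rep irrep_rep [OF assms(1)] assms(3)]
    by simp
  also have "\<dots> = (\<Sum>j<r. of_nat (m j) * \<chi> j g)"
    using carrier_matD [OF representation_carrier [OF irrep_rep assms(3)]]
    by (intro character_multiplicity_sum) simp
  finally show ?thesis .
qed

text \<open>This justifies the definite description. Existence is complete reducibility of each
  tensor product; uniqueness holds because the multiplicities are recovered by pairing with the
  irreducible characters.\<close>

lemma mckay_matrix_decomposition:
  assumes i: "i < r"
  shows "rep_iso G (tensor_rep \<rho> (\<sigma> i)) (multiplicity_sum r \<sigma> (\<lambda>j. edges i j))"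
proof -
  let ?P = "\<lambda>A. A \<in> carrier_mat r r \<and>
    (\<forall>i<r. rep_iso G (tensor_rep \<rho> (\<sigma> i)) (multiplicity_sum r \<sigma> (\<lambda>j. A $$ (i, j))))"
  have "\<exists>m. \<forall>i<r. rep_iso G (tensor_rep \<rho> (\<sigma> i)) (multiplicity_sum r \<sigma> (m i))"
  proof -
    have "\<exists>m. i < r \<longrightarrow> rep_iso G (tensor_rep \<rho> (\<sigma> i)) (multiplicity_sum r \<sigma> m)" for i
      using complete_reducibility [OF irreps finite_carrier tensor_representation [OF rep irrep_rep]]
      by blast
    then show ?thesis by metis
  qed
  then obtain m where m: "\<And>i. i < r \<Longrightarrow> rep_iso G (tensor_rep \<rho> (\<sigma> i)) (multiplicity_sum r \<sigma> (m i))"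
    by blast
  have "multiplicity_sum r \<sigma> (\<lambda>j. mat r r (\<lambda>(i, j). m i j) $$ (i, j)) = multiplicity_sum r \<sigma> (m i)"
    if "i < r" for i
    unfolding multiplicity_sum_def using that
    by (intro ext arg_cong [where f = diag_block_mat] arg_cong [where f = concat] map_cong) auto
  then have ex: "?P (mat r r (\<lambda>(i, j). m i j))" using m by simp
  have unique: "A = B" if A: "?P A" and B: "?P B" for A B
  proof (rule eq_matI)
    fix i k assume "i < dim_row B" "k < dim_col B"
    then have ik: "i < r" "k < r" using B by auto
    have "(\<Sum>j<r. of_nat (A $$ (i, j)) * \<chi> j g) = (\<Sum>j<r. of_nat (B $$ (i, j)) * \<chi> j g)"
      if "g \<in> carrier G" for g
    proof -
      from A ik(1) have "rep_iso G (tensor_rep \<rho> (\<sigma> i)) (multiplicity_sum r \<sigma> (\<lambda>j. A $$ (i, j)))" by blast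
      from decomposition_character [OF ik(1) this that]
      have "character \<rho> g * \<chi> i g = (\<Sum>j<r. of_nat (A $$ (i, j)) * \<chi> j g)" .
      moreover from B ik(1) have "rep_iso G (tensor_rep \<rho> (\<sigma> i)) (multiplicity_sum r \<sigma> (\<lambda>j. B $$ (i, j)))" by blast
      from decomposition_character [OF ik(1) this that]
      have "character \<rho> g * \<chi> i g = (\<Sum>j<r. of_nat (B $$ (i, j)) * \<chi> j g)" .
      ultimately show ?thesis by simp
    qed
    from char_form_combination [where K = "{..<r}", OF this order_refl ik(2)]
    have "of_nat (B $$ (i, k)) * of_nat (card (carrier G)) =
        char_form (carrier G) (\<lambda>g. \<Sum>j<r. of_nat (A $$ (i, j)) * \<chi> j g) (\<chi> k)"
      using ik by simp
    also have "\<dots> = of_nat (A $$ (i, k)) * of_nat (card (carrier G))"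
      using char_form_combination [where K = "{..<r}", OF refl order_refl ik(2)] ik by simp
    finally show "A $$ (i, k) = B $$ (i, k)" using card_nonzero by simp
  qed (use A B in auto)
  have "?P (THE A. ?P A)" by (rule theI [where P = ?P, OF ex unique [OF _ ex]])
  then show ?thesis using i by (simp add: mckay_matrix_def)
qed

lemma character_mult:
  assumes "i < r" "g \<in> carrier G"
  shows "character \<rho> g * \<chi> i g = (\<Sum>j<r. of_nat (edges i j) * \<chi> j g)"
  by (rule decomposition_character [OF assms(1) mckay_matrix_decomposition [OF assms(1)] assms(2)])

lemma normal_N: "N \<lhd> G"
proof -
  interpret group_hom G "GL n" \<rho>
    using rep group_GL by (auto simp: group_hom_def group_hom_axioms_def representation_def group_axioms)
  show ?thesis by (rule normal_kernel)
qed

lemma mem_N: "g \<in> N \<longleftrightarrow> g \<in> carrier G \<and> character \<rho> g = of_nat n"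
  using character_eq_degree [OF rep _ finite_carrier] by (auto simp: kernel_def GL_simps)

lemma subgroup_N: "subgroup N G"
  using normal_N by (rule normal_imp_subgroup)

lemma char_form_N_self: "i < r \<Longrightarrow> char_form N (\<chi> i) (\<chi> i) \<noteq> 0"
  using char_form_self_nonzero [OF irrep_rep degree_pos subgroup_N finite_carrier] .

lemma proportional:
  assumes "i < r" "j < r" "char_form N (\<chi> i) (\<chi> j) \<noteq> 0" "h \<in> N"
  shows "\<chi> i h = of_nat (d i) / of_nat (d j) * \<chi> j h"
  using character_proportional [OF normal_N assms(4) irrep irrep assms(3) finite_carrier]
    assms(1,2) degree_pos by (simp add: field_simps)

section \<open>Arcs, paths and multiples on the kernel\<close>

text \<open>If one character is \<open>c\<close> times the other on \<open>N\<close>, then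
  \<open>c\<close> is nonzero by evaluation at the unit, and the pairing is \<open>c\<close> times a
  nonzero self-pairing. The converse is proportionality, with the ratio of degrees as
  factor.\<close>

lemma multiples_iff:
  assumes i: "i < r" and j: "j < r"
  shows "multiples_on N (\<chi> i) (\<chi> j) \<longleftrightarrow> char_form N (\<chi> i) (\<chi> j) \<noteq> 0"
proof
  assume "multiples_on N (\<chi> i) (\<chi> j)"
  then obtain c where c: "\<And>h. h \<in> N \<Longrightarrow> \<chi> i h = c * \<chi> j h" by (auto simp: multiples_on_def)
  have "c \<noteq> 0"
    using c [OF subgroup.one_closed [OF subgroup_N]] i degree_pos [OF i] by (auto simp: character_one)
  moreover have "char_form N (\<chi> i) (\<chi> j) = c * char_form N (\<chi> j) (\<chi> j)"
    by (simp add: char_form_def c sum_distrib_left mult.assoc)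
  ultimately show "char_form N (\<chi> i) (\<chi> j) \<noteq> 0" using char_form_N_self [OF j] by simp
next
  assume nz: "char_form N (\<chi> i) (\<chi> j) \<noteq> 0"
  note p = proportional [OF i j nz]
  have "\<chi> j h = of_nat (d j) / of_nat (d i) * \<chi> i h" if "h \<in> N" for h
    using p [OF that] degree_pos [OF i] degree_pos [OF j] by simp
  then show "multiples_on N (\<chi> i) (\<chi> j)" using p unfolding multiples_on_def by blast
qed

lemma multiples_sym: "multiples_on N \<phi> \<psi> \<Longrightarrow> multiples_on N \<psi> \<phi>"
  by (auto simp: multiples_on_def)

lemma multiples_refl: "multiples_on N \<phi> \<phi>"
  by (auto simp: multiples_on_def intro!: exI [of _ 1])

lemma multiples_trans: "multiples_on N \<phi> \<psi> \<Longrightarrow> multiples_on N \<psi> \<theta> \<Longrightarrow> multiples_on N \<phi> \<theta>"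
  unfolding multiples_on_def by (metis mult.assoc)

text \<open>On \<open>N\<close> the character of \<open>\<rho> \<otimes> \<sigma>\<^sub>i\<close> is \<open>n \<cdot> \<chi>\<^sub>i\<close>, and every constituent pairs
  with \<open>\<chi>\<^sub>j\<close> to a nonnegative multiple of \<open>\<langle>\<chi>\<^sub>j, \<chi>\<^sub>j\<rangle>\<^sub>N\<close>.\<close>

lemma arc_imp_multiples:
  assumes i: "i < r" and j: "j < r" and arc: "0 < edges i j"
  shows "multiples_on N (\<chi> i) (\<chi> j)"
proof -
  let ?F = "\<lambda>i. char_form N (\<chi> i) (\<chi> j)"
  define t where "t k = (if ?F k = 0 then 0 else real (d k) / real (d j))" for k
  have F: "?F k = of_real (t k) * ?F j" if k: "k < r" for k
  proof (cases "?F k = 0")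
    case False
    have "?F k = (\<Sum>h\<in>N. of_real (t k) * (\<chi> j h * \<chi> j (inv h)))"
      unfolding char_form_def using False
      by (intro sum.cong refl) (simp add: proportional [OF k j False] t_def)
    then show ?thesis by (simp add: char_form_def sum_distrib_left)
  qed (simp add: t_def)
  have tj: "t j = 1" using char_form_N_self [OF j] degree_pos [OF j] by (simp add: t_def)
  have "of_nat n * ?F i = char_form N (\<lambda>h. of_nat n * \<chi> i h) (\<chi> j)"
    by (simp add: char_form_def sum_distrib_left mult.assoc)
  also have "\<dots> = (\<Sum>k<r. of_nat (edges i k) * ?F k)"
  proof (rule char_form_sum_left)
    show "N \<subseteq> carrier G" using subgroup.subset [OF subgroup_N] .
    show "of_nat n * \<chi> i g = (\<Sum>k<r. of_nat (edges i k) * \<chi> k g)" if "g \<in> N" for g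
      using character_mult [OF i, of g] that mem_N by simp
  qed
  also have "\<dots> = of_real (\<Sum>k<r. real (edges i k) * t k) * ?F j"
    using F by (simp add: sum_distrib_right mult.assoc)
  finally have "of_nat n * ?F i = of_real (\<Sum>k<r. real (edges i k) * t k) * ?F j" .
  \<comment> \<open>Because all \<open>t k\<close> are nonnegative reals, no cancellation can occur,
    and the arc to \<open>j\<close> contributes a positive term.\<close>
  moreover have "real (edges i j) * t j \<le> (\<Sum>k<r. real (edges i k) * t k)"
    using j by (intro member_le_sum) (auto simp: t_def)
  then have "(\<Sum>k<r. real (edges i k) * t k) \<noteq> 0" using arc tj by simp
  ultimately have "?F i \<noteq> 0" using char_form_N_self [OF j] by (metis mult_eq_0_iff of_real_eq_0_iff)
  then show ?thesis using multiples_iff [OF i j] by blast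
qed

lemma wf_quiver: "wf_digraph \<Gamma>"
  by (auto simp: mckay_quiver_def wf_digraph_def)

lemma quiver_adj: "(i, j) \<in> arcs_ends \<Gamma> \<longleftrightarrow> i < r \<and> j < r \<and> 0 < edges i j"
  by (force simp: mckay_quiver_def arcs_ends_def arc_to_ends_def image_iff)

lemma verts_quiver [simp]: "verts \<Gamma> = {..<r}"
  by (simp add: mckay_quiver_def)

text \<open>The span of the characters of the vertices reachable from \<open>i\<close> is closed under
  multiplication with the character of \<open>\<rho>\<close>, hence it contains \<open>1\<^sub>N \<cdot> \<chi>\<^sub>i\<close>, because \<open>1\<^sub>N\<close> is a
  polynomial in that character.\<close>

lemma multiples_imp_reachable:
  assumes i: "i < r" and j: "j < r" and multiples: "multiples_on N (\<chi> i) (\<chi> j)"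
  shows "i \<rightarrow>\<^sup>*\<^bsub>\<Gamma>\<^esub> j"
proof (rule ccontr)
  assume not_reachable: "\<not> i \<rightarrow>\<^sup>*\<^bsub>\<Gamma>\<^esub> j"
  interpret \<Gamma>: wf_digraph \<Gamma> by (rule wf_quiver)
  define R where "R = {k. i \<rightarrow>\<^sup>*\<^bsub>\<Gamma>\<^esub> k}"
  have R: "R \<subseteq> {..<r}" using \<Gamma>.reachable_in_verts(2) by (auto simp: R_def)
  have iR: "i \<in> R" using i by (simp add: R_def)
  have closed: "edges k l = 0" if "k \<in> R" "l < r" "l \<notin> R" for k l
    using that R quiver_adj [of k l] \<Gamma>.reachable_adj_trans [of i k l] by (auto simp: R_def)
  have finR: "finite R" using R finite_subset by blast
  define span where "span = {f. \<exists>c. \<forall>g\<in>carrier G. f g = (\<Sum>k\<in>R. c k * \<chi> k g)}"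
  have spanI: "f \<in> span" if "\<And>g. g \<in> carrier G \<Longrightarrow> f g = (\<Sum>k\<in>R. c k * \<chi> k g)" for f c
    using that by (auto simp: span_def)
  have step: "(\<lambda>g. character \<rho> g * f g) \<in> span" if f: "f \<in> span" for f
  proof -
    obtain c where c: "\<And>g. g \<in> carrier G \<Longrightarrow> f g = (\<Sum>k\<in>R. c k * \<chi> k g)" using f by (auto simp: span_def)
    show ?thesis
    proof (rule spanI)
      fix g assume g: "g \<in> carrier G"
      have "character \<rho> g * f g = (\<Sum>k\<in>R. c k * (character \<rho> g * \<chi> k g))"
        by (simp add: c [OF g] sum_distrib_left mult.left_commute)
      also have "\<dots> = (\<Sum>k\<in>R. c k * (\<Sum>l\<in>R. of_nat (edges k l) * \<chi> l g))"
      proof (intro sum.cong refl)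
        fix k assume k: "k \<in> R"
        then have "character \<rho> g * \<chi> k g = (\<Sum>l<r. of_nat (edges k l) * \<chi> l g)"
          using R character_mult [OF _ g] by blast
        also have "\<dots> = (\<Sum>l\<in>R. of_nat (edges k l) * \<chi> l g)"
          using R closed [OF k] by (intro sum.mono_neutral_right) auto
        finally show "c k * (character \<rho> g * \<chi> k g) = c k * (\<Sum>l\<in>R. of_nat (edges k l) * \<chi> l g)" by simp
      qed
      also have "\<dots> = (\<Sum>k\<in>R. \<Sum>l\<in>R. c k * of_nat (edges k l) * \<chi> l g)"
        by (simp add: sum_distrib_left mult.assoc)
      also have "\<dots> = (\<Sum>l\<in>R. \<Sum>k\<in>R. c k * of_nat (edges k l) * \<chi> l g)" by (rule sum.swap)
      finally show "character \<rho> g * f g = (\<Sum>l\<in>R. (\<Sum>k\<in>R. c k * of_nat (edges k l)) * \<chi> l g)"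
        by (simp add: sum_distrib_right)
    qed
  qed
  have add: "(\<lambda>g. a * \<chi> i g + f g) \<in> span" if f: "f \<in> span" for a f
  proof -
    obtain c where c: "\<And>g. g \<in> carrier G \<Longrightarrow> f g = (\<Sum>k\<in>R. c k * \<chi> k g)" using f by (auto simp: span_def)
    show ?thesis
    proof (rule spanI)
      fix g assume g: "g \<in> carrier G"
      have "(\<Sum>k\<in>R. ((if k = i then a else 0) + c k) * \<chi> k g) =
          (\<Sum>k\<in>R. if k = i then a * \<chi> i g else 0) + (\<Sum>k\<in>R. c k * \<chi> k g)"
        unfolding sum.distrib [symmetric] by (intro sum.cong) (auto simp: algebra_simps)
      then show "a * \<chi> i g + f g = (\<Sum>k\<in>R. ((if k = i then a else 0) + c k) * \<chi> k g)"
        using c [OF g] finR iR by simp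
    qed
  qed
  \<comment> \<open>Horner's scheme: each coefficient costs one multiplication by the character of
    \<rho> and one added multiple of the character at \<open>i\<close>.\<close>
  have poly: "(\<lambda>g. poly p (character \<rho> g) * \<chi> i g) \<in> span" for p
  proof (induction p)
    case 0
    show ?case by (rule spanI [of _ "\<lambda>_. 0"]) simp
  next
    case (pCons a p)
    from add [OF step [OF pCons.IH], of a] show ?case by (simp add: algebra_simps)
  qed
  \<comment> \<open>The roots are the finitely many values of the character other than
    \<open>n\<close>. These are its values off \<open>N\<close>, so up to a nonzero constant
    \<open>p\<close> evaluates to the indicator of \<open>N\<close>.\<close>
  define p where "p = (\<Prod>z\<in>character \<rho> ` carrier G - {of_nat n}. [:- z, 1:])"
  have p0: "poly p (character \<rho> g) = 0" if "g \<in> carrier G" "g \<notin> N" for g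
    using that mem_N finite_carrier by (auto simp: p_def poly_prod)
  have pn: "poly p (of_nat n) \<noteq> 0"
    using finite_carrier by (auto simp: p_def poly_prod)
  obtain c where "\<And>g. g \<in> carrier G \<Longrightarrow> poly p (character \<rho> g) * \<chi> i g = (\<Sum>k\<in>R. c k * \<chi> k g)"
    using poly [of p] by (auto simp: span_def)
  \<comment> \<open>As \<open>j\<close> lies outside \<open>R\<close>, pairing with its character
    gives zero; evaluating the same pairing directly leaves only the terms over
    \<open>N\<close>.\<close>
  from char_form_combination [OF this R j]
  have "char_form (carrier G) (\<lambda>g. poly p (character \<rho> g) * \<chi> i g) (\<chi> j) = 0"
    using not_reachable by (simp add: R_def)
  moreover have "char_form (carrier G) (\<lambda>g. poly p (character \<rho> g) * \<chi> i g) (\<chi> j) =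
      (\<Sum>g\<in>N. poly p (of_nat n) * (\<chi> i g * \<chi> j (inv g)))"
    unfolding char_form_def using finite_carrier mem_N p0
    by (intro sum.mono_neutral_cong_right) auto
  ultimately have "poly p (of_nat n) * char_form N (\<chi> i) (\<chi> j) = 0"
    by (simp add: char_form_def sum_distrib_left)
  then show False using pn multiples_iff [OF i j] multiples by simp
qed

end

theorem proposition3p1:
  fixes G :: "('g, 'b) monoid_scheme"
    and \<sigma> :: "nat \<Rightarrow> 'g \<Rightarrow> complex mat" and \<rho> :: "'g \<Rightarrow> complex mat"
    and d :: "nat \<Rightarrow> nat" and r n i j :: nat
  assumes "group G" and "finite (carrier G)"
    and "complete_irreps G r d \<sigma>"
    and "\<forall>g\<in>carrier G. \<sigma> 0 g = 1\<^sub>m 1"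
    and "representation G n \<rho>"
    and "i < r" and "j < r"
  defines "N \<equiv> kernel G (GL n) \<rho>"
    and "\<Gamma> \<equiv> mckay_quiver G r \<sigma> \<rho>"
  shows "(same_strong_component \<Gamma> i j \<longleftrightarrow> same_weak_component \<Gamma> i j) \<and>
         (same_weak_component \<Gamma> i j \<longleftrightarrow>
            multiples_on N (character (\<sigma> i)) (character (\<sigma> j)))"
proof -
  interpret mckay G r n d \<sigma> \<rho>
    using assms by (simp add: mckay_def mckay_axioms_def)
  interpret \<Gamma>: wf_digraph \<Gamma> unfolding \<Gamma>_def by (rule wf_quiver)
  have 1: "same_weak_component \<Gamma> i j" if "same_strong_component \<Gamma> i j"
    using \<Gamma>.same_strong_component_imp_reachable [OF that] by (rule \<Gamma>.same_weak_componentI)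
  have 2: "multiples_on N (character (\<sigma> i)) (character (\<sigma> j))" if "same_weak_component \<Gamma> i j"
  proof (rule \<Gamma>.same_weak_component_induct [OF that])
    fix x y assume "(x, y) \<in> arcs_ends \<Gamma>"
    then show "multiples_on N (character (\<sigma> x)) (character (\<sigma> y))"
      unfolding \<Gamma>_def N_def quiver_adj using arc_imp_multiples by blast
  next
    show "multiples_on N (character (\<sigma> x)) (character (\<sigma> x))" for x
      unfolding N_def by (rule multiples_refl)
  next
    show "multiples_on N (character (\<sigma> y)) (character (\<sigma> x))"
      if "multiples_on N (character (\<sigma> x)) (character (\<sigma> y))" for x y
      using that unfolding N_def by (rule multiples_sym)
  next
    show "multiples_on N (character (\<sigma> x)) (character (\<sigma> z))"
      if "multiples_on N (character (\<sigma> x)) (character (\<sigma> y))"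
        "multiples_on N (character (\<sigma> y)) (character (\<sigma> z))" for x y z
      using that unfolding N_def by (rule multiples_trans)
  qed
  \<comment> \<open>Symmetry of the relation gives a directed path in each direction, which is why
    the strong component is reached and not merely the weak one.\<close>
  have 3: "same_strong_component \<Gamma> i j" if "multiples_on N (character (\<sigma> i)) (character (\<sigma> j))"
    using that multiples_imp_reachable [of i j] multiples_imp_reachable [of j i] assms(6,7)
      multiples_sym [of "\<chi> i" "\<chi> j"]
    unfolding \<Gamma>_def N_def by (intro \<Gamma>.same_strong_componentI [unfolded \<Gamma>_def]) auto
  from 1 2 3 show ?thesis by blast
qed

end
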